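(* Let $\kappa\in\mathbb{N}_0$, let $(\mu_n,p_n)\in\mathbb{E}_{\le\kappa}$ for $n\in\mathbb{N}$, set $q_n:=\mathscr{C}_\kappa[\mu_n,p_n]$, and let $\mathring{q}$ be a holomorphic function on $\mathbb{C}^+$. Then the following three statements are equivalent: (i) there exists $M\subseteq\mathbb{C}^+$ such that $M$ has an accumulation point in $\mathbb{C}^+$ and $\lim_{n\to\infty}q_n(z)=\mathring{q}(z)$ for all $z\in M$; (ii) $\lim_{n\to\infty}q_n=\mathring{q}$ locally uniformly on $\mathbb{C}^+$; (iii) there exists $(\mathring{\mu},\mathring{p})\in\mathbb{E}_{\le\kappa}$ such that $\mathring{q}=\mathscr{C}_\kappa[\mathring{\mu},\mathring{p}]$, $\lim_{n\to\infty}p_n=\mathring{p}$, and for all $a,b\in\mathbb{R}$ with $a<b$ and $\mathring{\mu}(\{a\})=\mathring{\mu}(\{b\})=0$ one has $$\lim_{n\to\infty}\mu_n((a,b))=\mathring{\mu}((a,b)).$$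
   Context: "Measure" means positive Borel measure; $\mathbb{C}^+=\{z\in\mathbb{C}:\operatorname{Im}z>0\}$. For $\kappa\in\mathbb{N}_0$ let $\mathbb{E}_{\le\kappa}$ be the set of all pairs $(\mu,p)$ where $\mu$ is a measure on $\mathbb{R}$ with $\int_{\mathbb{R}}(1+t^2)^{-\kappa-1}d\mu(t)<\infty$, and $p$ is a polynomial with real coefficients of degree at most $2\kappa+1$ whose coefficient of $z^{2\kappa+1}$ satisfies $\frac{1}{(2\kappa+1)!}p^{(2\kappa+1)}(0)\ge\int_{\mathbb{R}}(1+t^2)^{-\kappa-1}d\mu(t)$. For $(\mu,p)\in\mathbb{E}_{\le\kappa}$ set $$\mathscr{C}_\kappa[\mu,p](z):=p(z)+(1+z^2)^{\kappa+1}\int_{\mathbb{R}}\frac{1}{t-z}\cdot\frac{d\mu(t)}{(1+t^2)^{\kappa+1}},\qquad z\in\mathbb{C}^+.$$ Convergence of polynomials (of degree at most $2\kappa+1$) means convergence of their coefficients. *)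

theory Defs
  imports "HOL-Analysis.Analysis" "HOL-Computational_Algebra.Polynomial"
begin

definition upper_half_plane :: "complex set" where
  "upper_half_plane = {z. Im z > 0}"

definition E_le :: "nat \<Rightarrow> (real measure \<times> real poly) set" where
  "E_le \<kappa> = {(\<mu>, p).
     sets \<mu> = sets borel \<and>
     integrable \<mu> (\<lambda>t. 1 / (1 + t\<^sup>2) ^ (\<kappa> + 1)) \<and>
     degree p \<le> 2 * \<kappa> + 1 \<and>
     coeff p (2 * \<kappa> + 1) \<ge> (LINT t|\<mu>. 1 / (1 + t\<^sup>2) ^ (\<kappa> + 1))}"

definition cauchy_type_transform :: "nat \<Rightarrow> real measure \<Rightarrow> real poly \<Rightarrow> complex \<Rightarrow> complex" where
  "cauchy_type_transform \<kappa> \<mu> p z =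
     poly (map_poly of_real p) z +
     (1 + z\<^sup>2) ^ (\<kappa> + 1) *
       (LINT t|\<mu>. 1 / (of_real t - z) * of_real (1 / (1 + t\<^sup>2) ^ (\<kappa> + 1)))"

definition locally_uniform_limit ::
  "'a::topological_space set \<Rightarrow> (nat \<Rightarrow> 'a \<Rightarrow> 'b::metric_space) \<Rightarrow> ('a \<Rightarrow> 'b) \<Rightarrow> bool" where
  "locally_uniform_limit S f l \<longleftrightarrow>
     (\<forall>x\<in>S. \<exists>U. open U \<and> x \<in> U \<and> uniform_limit (U \<inter> S) f l sequentially)"

definition poly_tendsto :: "(nat \<Rightarrow> real poly) \<Rightarrow> real poly \<Rightarrow> bool" where
  "poly_tendsto p l \<longleftrightarrow> (\<forall>i. (\<lambda>n. coeff (p n) i) \<longlonglongrightarrow> coeff l i)"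

end

theory Submission
  imports Defs "HOL-Probability.Probability" "HOL-Complex_Analysis.Complex_Analysis"
begin

text \<open>
  Put \<open>d\<sigma> = d\<mu> / (1 + t\<^sup>2)\<^bsup>\<kappa>+1\<^esup>\<close>, a finite measure, so that
  \<open>q = p + (1 + z\<^sup>2)\<^bsup>\<kappa>+1\<^esup> F\<close> with \<open>F\<close> the Cauchy transform of \<open>\<sigma>\<close>. As the second summand vanishes to
  order \<open>\<kappa> + 1\<close> at \<open>\<i>\<close> and \<open>p\<close> is real of degree at most \<open>2\<kappa> + 1\<close>, the polynomial \<open>p\<close> is the Hermite
  interpolant of \<open>q\<close> at \<open>\<plusminus>\<i>\<close>; its coefficients are bounded by the supremum of \<open>|q|\<close> on a circle
  around \<open>\<i>\<close>. Moreover the mass of \<open>\<sigma>\<close> is at most the leading coefficient of \<open>p\<close>.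

  If \<open>q\<^sub>n\<close> converges on \<open>M\<close> and the norms \<open>N\<^sub>n\<close> of \<open>p\<^sub>n\<close> were unbounded, then along a
  subsequence \<open>q\<^sub>n / N\<^sub>n\<close> would be locally bounded and tend to \<open>0\<close> on \<open>M\<close>, hence locally uniformly by
  Vitali's theorem, and so \<open>p\<^sub>n / N\<^sub>n\<close> would tend to \<open>0\<close>, which is absurd. Thus \<open>q\<^sub>n\<close> is locally bounded
  and Vitali's theorem gives locally uniform convergence, hence convergence of \<open>p\<^sub>n\<close>. The measures
  \<open>\<sigma>\<^sub>n\<close> then have bounded mass and vague limit points; mass escaping to infinity is harmless
  because the Cauchy kernel vanishes there. By Stieltjes inversion the limit point is unique.
\<close>

section \<open>Subsequences, the upper half-plane and locally uniform limits\<close>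

text \<open>If convergence fails, some property required by \<open>F\<close> fails at infinitely
  many indices; enumerating these gives a subsequence without convergent further subsequence. The
  filter form serves uniform limits, complex limits and limits in \<open>ennreal\<close>
  alike.\<close>

lemma filterlim_subseq_subseq:
  assumes "\<And>r :: nat \<Rightarrow> nat. strict_mono r \<Longrightarrow>
    \<exists>s :: nat \<Rightarrow> nat. strict_mono s \<and> filterlim (\<lambda>n. f (r (s n))) F sequentially"
  shows "filterlim f F sequentially"
  unfolding filterlim_iff
proof (intro allI impI)
  fix P assume P: "eventually P F"
  show "eventually (\<lambda>n. P (f n)) sequentially"
  proof (rule ccontr)
    assume "\<not> eventually (\<lambda>n. P (f n)) sequentially"
    then have "infinite {n. \<not> P (f n)}"
      by (simp add: infinite_nat_iff_unbounded_le eventually_sequentially)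
    then obtain r :: "nat \<Rightarrow> nat" where r: "strict_mono r" "\<And>n. \<not> P (f (r n))"
      using infinite_enumerate by blast
    then obtain s :: "nat \<Rightarrow> nat" where "filterlim (\<lambda>n. f (r (s n))) F sequentially"
      using assms by blast
    then have "eventually (\<lambda>n. P (f (r (s n)))) sequentially"
      using P by (simp add: filterlim_iff)
    then show False
      using r(2) by simp
  qed
qed

lemma mem_upper_half_plane: "z \<in> upper_half_plane \<longleftrightarrow> Im z > 0"
  by (simp add: upper_half_plane_def)

lemma open_upper_half_plane: "open upper_half_plane"
  unfolding upper_half_plane_def by (rule open_halfspace_Im_gt)

lemma connected_upper_half_plane: "connected upper_half_plane"
  unfolding upper_half_plane_def by (intro convex_connected convex_halfspace_Im_gt)

text \<open>A compact set needs only finitely many of the given neighbourhoods; conversely a closed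
  ball inside the open set \<open>S\<close> is compact.\<close>

lemma locally_uniform_limit_iff_compact:
  fixes S :: "'a::heine_borel set"
  assumes "open S"
  shows "locally_uniform_limit S f l \<longleftrightarrow>
    (\<forall>K. compact K \<and> K \<subseteq> S \<longrightarrow> uniform_limit K f l sequentially)"
proof (intro iffI allI impI)
  fix K assume L: "locally_uniform_limit S f l" and K: "compact K \<and> K \<subseteq> S"
  from L obtain U where U: "\<And>x. x \<in> S \<Longrightarrow> open (U x) \<and> x \<in> U x \<and> uniform_limit (U x \<inter> S) f l sequentially"
    unfolding locally_uniform_limit_def by metis
  have "K \<subseteq> (\<Union>x\<in>K. U x)" using U K by blast
  then obtain D where D: "D \<subseteq> K" "finite D" "K \<subseteq> (\<Union>x\<in>D. U x)"
    using K U compactE_image[of K K U] by (metis subsetD)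
  have "uniform_limit (\<Union>x\<in>D. U x \<inter> S) f l sequentially"
    using D U K by (intro uniform_limit_on_UNION) auto
  then show "uniform_limit K f l sequentially"
    by (rule uniform_limit_on_subset) (use D K in auto)
next
  assume L: "\<forall>K. compact K \<and> K \<subseteq> S \<longrightarrow> uniform_limit K f l sequentially"
  show "locally_uniform_limit S f l"
    unfolding locally_uniform_limit_def
  proof
    fix x assume "x \<in> S"
    then obtain e where e: "e > 0" "cball x e \<subseteq> S"
      using assms open_contains_cball by blast
    then have "uniform_limit (cball x e) f l sequentially" using L by simp
    then have "uniform_limit (ball x e \<inter> S) f l sequentially"
      by (rule uniform_limit_on_subset) auto
    then show "\<exists>U. open U \<and> x \<in> U \<and> uniform_limit (U \<inter> S) f l sequentially"
      using e by (intro exI[of _ "ball x e"]) auto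
  qed
qed

section \<open>Cauchy transforms of finite measures\<close>

definition cauchy_transform :: "real measure \<Rightarrow> complex \<Rightarrow> complex" where
  "cauchy_transform \<sigma> z = (LINT t|\<sigma>. 1 / (of_real t - z))"

lemma norm_cauchy_kernel_le:
  assumes "Im z > 0"
  shows "norm (1 / (of_real t - z)) \<le> 1 / Im z"
proof -
  have "Im z \<le> norm (of_real t - z)"
    using abs_Im_le_cmod[of "of_real t - z"] assms by simp
  with assms show ?thesis by (simp add: norm_divide frac_le)
qed

lemma of_real_diff_nonzero: "Im z > 0 \<Longrightarrow> of_real t - z \<noteq> 0"
  by (auto simp: complex_eq_iff)

context finite_borel_measure
begin

declare M_is_borel [measurable_cong]

lemma space_eq_UNIV: "space M = UNIV"
  using sets_eq_imp_space_eq[OF M_is_borel] by simp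

lemma integrable_cauchy_kernel:
  assumes "Im z > 0"
  shows "integrable M (\<lambda>t. 1 / (complex_of_real t - z))"
  by (rule integrable_const_bound[where B = "1 / Im z"])
     (use norm_cauchy_kernel_le[OF assms] in auto)

lemma norm_integral_le_mass:
  fixes f :: "real \<Rightarrow> 'b::{banach, second_countable_topology}"
  assumes "\<And>t. norm (f t) \<le> B"
  shows "norm (LINT t|M. f t) \<le> B * measure M UNIV"
proof (cases "integrable M f")
  case True
  have "norm (LINT t|M. f t) \<le> (LINT t|M. norm (f t))"
    by (rule integral_norm_bound)
  also have "\<dots> \<le> (LINT t|M. B)"
    using True assms by (intro integral_mono) auto
  finally show ?thesis by (simp add: space_eq_UNIV mult.commute)
next
  \<comment> \<open>The integral of a non-integrable function is 0 by convention, so it remains to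
    see that the bound is nonnegative.\<close>
  case False
  moreover have "0 \<le> B" using assms norm_ge_zero order_trans by blast
  ultimately show ?thesis by (simp add: not_integrable_integral_eq)
qed

lemma norm_cauchy_transform_le:
  assumes "Im z > 0"
  shows "norm (cauchy_transform M z) \<le> measure M UNIV / Im z"
  using norm_integral_le_mass[of "\<lambda>t. 1 / (complex_of_real t - z)" "1 / Im z"]
    norm_cauchy_kernel_le[OF assms] by (simp add: cauchy_transform_def)

text \<open>Differentiation under the integral sign: the difference quotient of the kernel minus its
  derivative is exactly \<open>w - z\<close> times a product of kernels whose integral stays bounded
  for \<open>w\<close> near \<open>z\<close>.\<close>

lemma holomorphic_cauchy_transform: "cauchy_transform M holomorphic_on upper_half_plane"
proof -
  have "(cauchy_transform M has_field_derivative (LINT t|M. (1 / (of_real t - z))\<^sup>2)) (at z)"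
    if z: "Im z > 0" for z
  proof -
    define Q where "Q w = (cauchy_transform M w - cauchy_transform M z) / (w - z)" for w
    let ?k = "\<lambda>w t. 1 / (complex_of_real t - w)"
    have int2: "integrable M (\<lambda>t. (?k z t)\<^sup>2)"
      using norm_cauchy_kernel_le[OF z]
      by (intro integrable_const_bound[where B = "(1 / Im z)\<^sup>2"])
         (auto simp: norm_power intro!: power_mono simp del: norm_divide)
    \<comment> \<open>For \<open>Im w > Im z / 2\<close> the kernel at \<open>w\<close> is at most
      \<open>2 / Im z\<close>; the two kernels at \<open>z\<close> contribute
      \<open>1 / Im z\<close> each.\<close>
    have bound: "norm (Q w - (LINT t|M. (?k z t)\<^sup>2)) \<le> norm (w - z) * (2 / Im z ^ 3 * measure M UNIV)"
      if w: "w \<noteq> z" "Im w > Im z / 2" for w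
    proof -
      have w0: "Im w > 0" using w z by simp
      have "Q w - (LINT t|M. (?k z t)\<^sup>2) = (LINT t|M. (?k w t - ?k z t) / (w - z) - (?k z t)\<^sup>2)"
        unfolding Q_def cauchy_transform_def
        using integrable_cauchy_kernel[OF w0] integrable_cauchy_kernel[OF z] int2 by simp
      also have "\<dots> = (LINT t|M. (w - z) * (?k w t * (?k z t)\<^sup>2))"
      proof (rule Bochner_Integration.integral_cong[OF refl])
        fix t
        \<comment> \<open>Here \<open>A = t - w\<close>, \<open>B = t - z\<close>,
          \<open>d = w - z\<close>. Then \<open>a - b = d * a * b\<close>, so the left side is
          \<open>a * b - b * b = b * (a - b)\<close>.\<close>
        have alg: "a = 1 / A \<Longrightarrow> b = 1 / B \<Longrightarrow> A \<noteq> 0 \<Longrightarrow> B \<noteq> 0 \<Longrightarrow> d \<noteq> 0 \<Longrightarrow> B - A = d \<Longrightarrow>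
            (a - b) / d - b\<^sup>2 = d * (a * b\<^sup>2)" for a b A B d :: complex
          by (simp add: diff_frac_eq power2_eq_square) (simp add: divide_simps, metis left_diff_distrib)
        show "(?k w t - ?k z t) / (w - z) - (?k z t)\<^sup>2 = (w - z) * (?k w t * (?k z t)\<^sup>2)"
          by (rule alg[OF refl refl]) (use w0 z w(1) of_real_diff_nonzero in auto)
      qed
      also have "norm \<dots> = norm (w - z) * norm (LINT t|M. ?k w t * (?k z t)\<^sup>2)"
        by (simp only: integral_mult_right_zero norm_mult)
      also have "norm (LINT t|M. ?k w t * (?k z t)\<^sup>2) \<le> 2 / Im z ^ 3 * measure M UNIV"
      proof (rule norm_integral_le_mass)
        fix t
        have "norm (?k w t * (?k z t)\<^sup>2) \<le> 2 / Im z * (1 / Im z)\<^sup>2"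
          unfolding norm_mult norm_power
        proof (intro mult_mono power_mono)
          show "norm (?k w t) \<le> 2 / Im z"
            using w z by (intro order_trans[OF norm_cauchy_kernel_le[OF w0]]) (simp add: field_simps)
        qed (use norm_cauchy_kernel_le[OF z] z in auto)
        then show "norm (?k w t * (?k z t)\<^sup>2) \<le> 2 / Im z ^ 3"
          by (simp add: power2_eq_square power3_eq_cube)
      qed
      finally show ?thesis by (simp add: mult_left_mono)
    qed
    have "((\<lambda>w. Q w - (LINT t|M. (?k z t)\<^sup>2)) \<longlongrightarrow> 0) (at z)"
    proof (rule Lim_null_comparison)
      have "open {w. Im w > Im z / 2}" by (rule open_halfspace_Im_gt)
      then have "\<forall>\<^sub>F w in nhds z. w \<in> {w. Im w > Im z / 2}"
        using z by (intro eventually_nhds_in_open) auto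
      then have "\<forall>\<^sub>F w in at z. Im w > Im z / 2"
        unfolding eventually_at_filter by (auto elim: eventually_mono)
      moreover have "\<forall>\<^sub>F w in at z. w \<noteq> z" by (simp add: eventually_at_filter)
      ultimately show "\<forall>\<^sub>F w in at z. norm (Q w - (LINT t|M. (?k z t)\<^sup>2)) \<le>
          norm (w - z) * (2 / Im z ^ 3 * measure M UNIV)"
        by eventually_elim (rule bound)
      show "((\<lambda>w. norm (w - z) * (2 / Im z ^ 3 * measure M UNIV)) \<longlongrightarrow> 0) (at z)"
        using z by (auto intro!: tendsto_eq_intros)
    qed
    then show ?thesis
      unfolding has_field_derivative_iff Q_def by (simp add: LIM_zero_iff)
  qed
  then show ?thesis
    unfolding holomorphic_on_def field_differentiable_def
    using mem_upper_half_plane has_field_derivative_at_within by blast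
qed

end

section \<open>Hermite interpolation at the imaginary unit\<close>

text \<open>In the induction step \<open>p\<close> is divided by \<open>1 + x\<^sup>2\<close>: the real linear remainder is determined by the
  value at \<open>\<i>\<close>, which the maximum principle controls.\<close>
lemma real_poly_bound_exists:
  "\<exists>C. \<forall>(p :: real poly) F B.
    (\<forall>i\<ge>2 * k. coeff p i = 0) \<longrightarrow> F holomorphic_on upper_half_plane \<longrightarrow>
    (\<forall>z\<in>sphere \<i> (1/2). norm (poly (map_poly of_real p) z + (1 + z\<^sup>2) ^ k * F z) \<le> B) \<longrightarrow>
    (\<forall>i. \<bar>coeff p i\<bar> \<le> C * B)"
proof (induction k)
  case 0
  have "\<bar>coeff p i\<bar> \<le> 1 * B" if "\<forall>i\<ge>2 * 0. coeff p i = 0"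
    "\<forall>z\<in>sphere \<i> (1/2). norm (poly (map_poly of_real p) z + (1 + z\<^sup>2) ^ 0 * F z) \<le> B"
    for p :: "real poly" and F B i
  proof -
    \<comment> \<open>For \<open>k = 0\<close> the polynomial is 0 and the claim reduces to
      \<open>0 \<le> B\<close>, which any point of the sphere provides.\<close>
    have "\<i> + 1/2 \<in> sphere \<i> (1/2)" by (simp add: dist_norm)
    then have "norm (poly (map_poly of_real p) (\<i> + 1/2) + (1 + (\<i> + 1/2)\<^sup>2) ^ 0 * F (\<i> + 1/2)) \<le> B"
      using that(2) by blast
    then have "0 \<le> B" by (rule order_trans[OF norm_ge_zero])
    then show ?thesis using that(1) by simp
  qed
  then show ?case by blast
next
  case (Suc k)
  then obtain C where C: "\<And>(p :: real poly) F B i.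
    \<forall>i\<ge>2 * k. coeff p i = 0 \<Longrightarrow> F holomorphic_on upper_half_plane \<Longrightarrow>
    \<forall>z\<in>sphere \<i> (1/2). norm (poly (map_poly of_real p) z + (1 + z\<^sup>2) ^ k * F z) \<le> B \<Longrightarrow>
    \<bar>coeff p i\<bar> \<le> C * B" by metis
  \<comment> \<open>The constant has \<open>1\<close> for the remainder and twice
    \<open>C * 14 / 3\<close> for the quotient \<open>s\<close>: a coefficient of
    \<open>d * s\<close> is a sum of at most two coefficients of \<open>s\<close>.\<close>
  have "\<bar>coeff p i\<bar> \<le> (1 + 2 * C * 14 / 3) * B"
    if p: "\<forall>i\<ge>2 * Suc k. coeff p i = 0" and F: "F holomorphic_on upper_half_plane"
      and B: "\<forall>z\<in>sphere \<i> (1/2). norm (poly (map_poly of_real p) z + (1 + z\<^sup>2) ^ Suc k * F z) \<le> B"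
    for p :: "real poly" and F B i
  proof -
    define d :: "real poly" where "d = [:1, 0, 1:]"
    define s where "s = p div d"
    define \<alpha> where "\<alpha> = coeff (p mod d) 0"
    define \<beta> where "\<beta> = coeff (p mod d) 1"
    have d: "d \<noteq> 0" "degree d = 2" by (auto simp: d_def)
    have "degree (p mod d) < 2" using degree_mod_less'[of d p] d by fastforce
    then have "p mod d = [:\<alpha>, \<beta>:]"
      by (intro poly_eqI) (auto simp: \<alpha>_def \<beta>_def coeff_pCons coeff_eq_0 split: nat.splits)
    then have ps: "p = [:\<alpha>, \<beta>:] + d * s"
      unfolding s_def by (metis add.commute div_mult_mod_eq mult.commute)
    define f where "f z = poly (map_poly of_real p) z + (1 + z\<^sup>2) ^ Suc k * F z" for z :: complex
    have peval: "poly (map_poly of_real p) z = of_real \<alpha> + of_real \<beta> * z + (1 + z\<^sup>2) * poly (map_poly of_real s) z"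
      for z :: complex
    proof -
      have "map_poly complex_of_real p = [:of_real \<alpha>, of_real \<beta>:] + [:1, 0, 1:] * map_poly of_real s"
        by (rule poly_eqI) (subst ps, simp add: coeff_map_poly d_def coeff_pCons split: nat.splits)
      then show ?thesis by (simp add: algebra_simps power2_eq_square)
    qed
    have fz: "f z = of_real \<alpha> + of_real \<beta> * z + (1 + z\<^sup>2) * (poly (map_poly of_real s) z + (1 + z\<^sup>2) ^ k * F z)" for z
      unfolding f_def peval by (simp add: algebra_simps)
    have cb: "cball \<i> (1/2) \<subseteq> upper_half_plane"
    proof
      fix z assume "z \<in> cball \<i> (1/2)"
      then have "\<bar>Im (\<i> - z)\<bar> \<le> 1/2"
        using abs_Im_le_cmod[of "\<i> - z"] by (simp add: dist_norm)
      then show "z \<in> upper_half_plane" by (simp add: mem_upper_half_plane abs_if split: if_splits)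
    qed
    have holf: "f holomorphic_on upper_half_plane"
      unfolding f_def by (intro holomorphic_intros F)
    have "norm (f \<i>) \<le> B"
    proof (rule maximum_modulus_frontier[where f = f and S = "cball \<i> (1/2)"])
      show "f holomorphic_on interior (cball \<i> (1/2))"
        by (rule holomorphic_on_subset[OF holf]) (use cb in auto)
      show "continuous_on (closure (cball \<i> (1/2))) f"
        using holomorphic_on_imp_continuous_on[OF holf] cb by (simp add: continuous_on_subset)
    qed (use B in \<open>auto simp: f_def\<close>)
    \<comment> \<open>As \<open>1 + z\<^sup>2\<close> vanishes at \<open>\<i>\<close>,
      \<open>f \<i>\<close> equals \<open>\<alpha> + \<beta> * \<i>\<close>. Since the coefficients
      are real, they are its real and imaginary parts.\<close>
    then have ab: "\<bar>\<alpha>\<bar> \<le> B" "\<bar>\<beta>\<bar> \<le> B"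
      using abs_Re_le_cmod[of "f \<i>"] abs_Im_le_cmod[of "f \<i>"] by (auto simp: fz)
    have "coeff s i = 0" if "i \<ge> 2 * k" for i
    proof (cases "s = 0")
      case False
      have "degree (d * s) = 2 + degree s" using d False by (simp add: degree_mult_eq)
      moreover have "degree p = degree (d * s)"
        unfolding ps by (rule degree_add_eq_right) (use calculation in auto)
      moreover have "degree p < 2 * Suc k"
        using p False ps d calculation by (metis leading_coeff_0_iff not_less degree_0 add_is_0 zero_neq_numeral)
      ultimately show ?thesis using that by (simp add: coeff_eq_0)
    qed auto
    \<comment> \<open>On the sphere \<open>norm (1 + z\<^sup>2)\<close> is at least
      \<open>1/2 * 3/2 = 3/4\<close>, while \<open>f\<close> minus the remainder is at most
      \<open>B + B + 3/2 * B = 7/2 * B\<close>. The quotient of the two constants is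
      \<open>14/3\<close>.\<close>
    moreover have "norm (poly (map_poly of_real s) z + (1 + z\<^sup>2) ^ k * F z) \<le> 14 / 3 * B"
      if z: "z \<in> sphere \<i> (1/2)" for z
    proof -
      define g where "g = poly (map_poly of_real s) z + (1 + z\<^sup>2) ^ k * F z"
      have 1: "norm (z - \<i>) = 1/2" using z by (simp add: dist_norm norm_minus_commute)
      have 2: "norm (z + \<i>) \<ge> 3/2"
        using norm_triangle_ineq2[of "2 * \<i>" "- (z - \<i>)"] 1 by (simp add: norm_mult add.commute norm_minus_commute)
      have 3: "norm z \<le> 3/2" using norm_triangle_ineq[of "z - \<i>" \<i>] 1 by simp
      have "1 + z\<^sup>2 = (z - \<i>) * (z + \<i>)" by (simp add: algebra_simps power2_eq_square)
      then have "norm (1 + z\<^sup>2) = 1/2 * norm (z + \<i>)" by (simp only: norm_mult 1)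
      then have 4: "norm (1 + z\<^sup>2) \<ge> 3/4" using 2 by simp
      have "3/4 * norm g \<le> norm (1 + z\<^sup>2) * norm g" using 4 by (intro mult_right_mono) auto
      also have "\<dots> = norm (f z - (of_real \<alpha> + of_real \<beta> * z))"
        by (simp add: fz g_def norm_mult)
      also have "\<dots> \<le> norm (f z) + (\<bar>\<alpha>\<bar> + \<bar>\<beta>\<bar> * norm z)"
        by (intro order_trans[OF norm_triangle_ineq4] add_left_mono order_trans[OF norm_triangle_ineq])
           (simp add: norm_mult)
      also have "\<dots> \<le> B + (B + B * (3/2))"
        using ab 3 B z by (intro add_mono mult_mono) (auto simp: f_def)
      finally show ?thesis unfolding g_def by simp
    qed
    ultimately have s: "\<bar>coeff s j\<bar> \<le> C * (14/3 * B)" for j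
      using C[of s F "14/3 * B" j] F by blast
    have "coeff p i = coeff [:\<alpha>, \<beta>:] i + coeff s i + (if i \<ge> 2 then coeff s (i - 2) else 0)"
      by (subst ps) (auto simp: d_def coeff_pCons numeral_2_eq_2 split: nat.splits)
    moreover have "\<bar>coeff [:\<alpha>, \<beta>:] i\<bar> \<le> B"
      using ab order_trans[OF abs_ge_zero ab(1)] by (auto simp: coeff_pCons split: nat.splits)
    \<comment> \<open>For \<open>i < 2\<close> the bound holds because it dominates an absolute
      value and is therefore nonnegative.\<close>
    moreover have "\<bar>if i \<ge> 2 then coeff s (i - 2) else 0\<bar> \<le> C * (14/3 * B)"
      using s[of "i - 2"] order_trans[OF abs_ge_zero s] by auto
    ultimately have "\<bar>coeff p i\<bar> \<le> B + C * (14/3 * B) + C * (14/3 * B)"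
      using s[of i] by linarith
    then show ?thesis by (simp add: algebra_simps)
  qed
  then show ?case by blast
qed

section \<open>Vague compactness\<close>

text \<open>The angular variable compactifies the line: escaping mass collects at +-pi/2.
  Normalisation to mass 1 opens the way to Helly's theorem for probability laws. For a null measure
  the point mass at 0 is a placeholder, as integrals are later multiplied back by the total
  mass.\<close>

definition arctan_law :: "real measure \<Rightarrow> real measure" where
  "arctan_law \<sigma> = (if measure \<sigma> UNIV = 0 then return borel 0
    else distr (density \<sigma> (\<lambda>_. ennreal (1 / measure \<sigma> UNIV))) borel arctan)"

text \<open>The restriction to the open interval discards the mass that has escaped to infinity.\<close>
definition tan_measure :: "real \<Rightarrow> real measure \<Rightarrow> real measure" where
  "tan_measure m T = distr (density T (\<lambda>x. ennreal (m * indicator {-(pi/2)<..<pi/2} x))) borel tan"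

context finite_borel_measure
begin

lemma real_distribution_arctan_law: "real_distribution (arctan_law M)"
proof (cases "measure M UNIV = 0")
  case True
  then show ?thesis
    unfolding arctan_law_def real_distribution_def real_distribution_axioms_def
    by (auto intro: prob_space_return)
next
  case False
  let ?d = "density M (\<lambda>_. ennreal (1 / measure M UNIV))"
  have "emeasure ?d (space M) = ennreal (1 / measure M UNIV) * emeasure M (space M)"
    by (simp add: emeasure_density nn_integral_cmult_indicator)
  also have "\<dots> = 1"
    using False by (simp add: space_eq_UNIV emeasure_eq_measure flip: ennreal_mult)
  finally have "prob_space ?d" by (intro prob_spaceI) simp
  then have "prob_space (distr ?d borel arctan)"
    by (rule prob_space.prob_space_distr) simp
  then show ?thesis
    using False by (simp add: arctan_law_def real_distribution_def real_distribution_axioms_def)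
qed

lemma integral_null:
  fixes f :: "real \<Rightarrow> 'b::{banach, second_countable_topology}"
  assumes "measure M UNIV = 0"
  shows "(LINT t|M. f t) = 0"
proof -
  have "AE t in M. False"
    using assms emeasure_eq_measure[of UNIV]
    by (intro AE_I[where N = UNIV]) (auto simp: M_is_borel)
  then show ?thesis by (intro integral_eq_zero_AE) auto
qed

lemma integral_arctan_law:
  fixes k :: "real \<Rightarrow> 'b::{banach, second_countable_topology}"
  assumes [measurable]: "k \<in> borel_measurable borel"
  shows "(LINT t|M. k (arctan t)) = measure M UNIV *\<^sub>R (LINT x|arctan_law M. k x)"
proof (cases "measure M UNIV = 0")
  case False
  have "(LINT x|arctan_law M. k x) =
      (LINT t|density M (\<lambda>_. ennreal (1 / measure M UNIV)). k (arctan t))"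
    using False unfolding arctan_law_def by (simp only: if_False) (rule integral_distr; simp)
  also have "\<dots> = (LINT t|M. (1 / measure M UNIV) *\<^sub>R k (arctan t))"
    by (rule integral_density) auto
  finally show ?thesis using False by simp
qed (simp add: integral_null)

text \<open>Since \<open>2\<close> exceeds pi/2, one interval carries every angular law, the
  placeholder at 0 included; this makes any family of them tight.\<close>

lemma measure_arctan_law: "measure (arctan_law M) {-2<..2} = 1"
proof (cases "measure M UNIV = 0")
  case False
  interpret real_distribution "arctan_law M" by (rule real_distribution_arctan_law)
  have "arctan t \<in> {-2<..2}" for t
    using arctan_bounded[of t] pi_half_less_two by auto
  then have "AE x in arctan_law M. x \<in> {-2<..2}"
    unfolding arctan_law_def using False by (simp add: AE_distr_iff)
  then show ?thesis by (subst prob_eq_1) auto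
qed (simp add: arctan_law_def measure_return)

end

lemma borel_measurable_tan_real [measurable]: "(tan :: real \<Rightarrow> real) \<in> borel_measurable borel"
  unfolding tan_def by simp

context real_distribution
begin

lemma integral_tan_measure:
  fixes h :: "real \<Rightarrow> 'b::{banach, second_countable_topology}"
  assumes [measurable]: "h \<in> borel_measurable borel" and "m \<ge> 0"
  shows "(LINT t|tan_measure m M. h t) = m *\<^sub>R (LINT x|M. indicator {-(pi/2)<..<pi/2} x *\<^sub>R h (tan x))"
proof -
  have "(LINT t|tan_measure m M. h t) =
      (LINT x|density M (\<lambda>x. ennreal (m * indicator {-(pi/2)<..<pi/2} x)). h (tan x))"
    unfolding tan_measure_def by (rule integral_distr) simp_all
  also have "\<dots> = (LINT x|M. (m * indicator {-(pi/2)<..<pi/2} x) *\<^sub>R h (tan x))"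
    by (rule integral_density) (use assms(2) in auto)
  finally show ?thesis by (simp flip: scaleR_scaleR)
qed

lemma emeasure_tan_measure:
  assumes [measurable]: "A \<in> sets borel" and "m \<ge> 0"
  shows "emeasure (tan_measure m M) A = ennreal (m * measure M ({-(pi/2)<..<pi/2} \<inter> tan -` A))"
proof -
  let ?I = "{-(pi/2)<..<pi/2}"
  have "tan -` A \<inter> space borel \<in> sets borel" by measurable
  then have [measurable]: "tan -` A \<in> sets (borel :: real measure)" by simp
  have "emeasure (tan_measure m M) A = (\<integral>\<^sup>+x. ennreal (m * indicator ?I x) * indicator (tan -` A) x \<partial>M)"
    unfolding tan_measure_def by (simp add: emeasure_distr emeasure_density)
  also have "\<dots> = (\<integral>\<^sup>+x. ennreal m * indicator (?I \<inter> tan -` A) x \<partial>M)"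
    by (intro nn_integral_cong) (auto simp: indicator_def)
  also have "\<dots> = ennreal m * emeasure M (?I \<inter> tan -` A)"
    by (simp add: nn_integral_cmult_indicator)
  finally show ?thesis
    using assms(2) by (simp add: emeasure_eq_measure ennreal_mult)
qed

lemma measure_tan_measure:
  assumes "A \<in> sets borel" "m \<ge> 0"
  shows "measure (tan_measure m M) A = m * measure M ({-(pi/2)<..<pi/2} \<inter> tan -` A)"
  using emeasure_tan_measure[OF assms] assms(2) by (simp add: measure_def[of "tan_measure m M"])

lemma finite_borel_measure_tan_measure:
  assumes "m \<ge> 0"
  shows "finite_borel_measure (tan_measure m M)"
proof -
  have "finite_measure (tan_measure m M)"
    using emeasure_tan_measure[of UNIV m] assms
    by (intro finite_measureI) (simp add: tan_measure_def)
  then show ?thesis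
    by (simp add: finite_borel_measure_def finite_borel_measure_axioms_def tan_measure_def)
qed

end

text \<open>Weak convergence of the angular laws times convergence of the masses. The condition on
  discontinuities of \<open>k\<close> includes +-pi/2, where escaped mass collects: there
  \<open>k\<close> has to be continuous unless \<open>T\<close> has no atom.\<close>

lemma tendsto_integral_tan_measure:
  fixes h k :: "real \<Rightarrow> 'b::{banach, second_countable_topology}"
  assumes fin: "\<And>n. finite_borel_measure (\<sigma> n)"
    and mass: "(\<lambda>n. measure (\<sigma> n) UNIV) \<longlonglongrightarrow> m"
    and T: "real_distribution T" "weak_conv_m (\<lambda>n. arctan_law (\<sigma> n)) T"
    and k: "\<And>x. k x = (if x \<in> {-(pi/2)<..<pi/2} then h (tan x) else 0)"
    and [measurable]: "h \<in> borel_measurable borel"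
    and B: "\<And>x. norm (h x) \<le> B"
    and disc: "m \<noteq> 0 \<Longrightarrow> measure T {x. \<not> isCont k x} = 0"
  shows "(\<lambda>n. LINT t|\<sigma> n. h t) \<longlonglongrightarrow> (LINT t|tan_measure m T. h t)"
proof -
  interpret \<sigma>: finite_borel_measure "\<sigma> n" for n by (rule fin)
  interpret T: real_distribution T by (rule T)
  have m: "m \<ge> 0" using mass by (intro LIMSEQ_le_const) auto
  have keq: "k = (\<lambda>x. indicator {-(pi/2)<..<pi/2} x *\<^sub>R h (tan x))"
    by (rule ext) (simp add: k)
  have [measurable]: "k \<in> borel_measurable borel" unfolding keq by measurable
  have kB: "norm (k x) \<le> B" for x
    using B[of "tan x"] order_trans[OF norm_ge_zero B] by (auto simp: k)
  have "k (arctan t) = h t" for t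
    using arctan_bounded[of t] by (simp add: k arctan)
  then have 1: "(LINT t|\<sigma> n. h t) = measure (\<sigma> n) UNIV *\<^sub>R (LINT x|arctan_law (\<sigma> n). k x)" for n
    using \<sigma>.integral_arctan_law[of k n] by simp
  have 2: "(LINT t|tan_measure m T. h t) = m *\<^sub>R (LINT x|T. k x)"
    unfolding keq by (rule T.integral_tan_measure) (use m in auto)
  show ?thesis
  proof (cases "m = 0")
    \<comment> \<open>If the masses tend to 0, so do the integrals of a function bounded by
      \<open>B\<close>, and the limit carries the factor \<open>m = 0\<close>.\<close>
    case True
    have "norm (LINT t|\<sigma> n. h t) \<le> B * measure (\<sigma> n) UNIV" for n
      by (rule \<sigma>.norm_integral_le_mass) (rule B)
    moreover have "(\<lambda>n. B * measure (\<sigma> n) UNIV) \<longlonglongrightarrow> 0"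
      using tendsto_mult_left[OF mass, of B] True by simp
    ultimately have "(\<lambda>n. LINT t|\<sigma> n. h t) \<longlonglongrightarrow> 0"
      by (rule Lim_null_comparison[OF always_eventually[OF allI]])
    then show ?thesis using 2 True by simp
  next
    case False
    have "(\<lambda>n. integral\<^sup>L (arctan_law (\<sigma> n)) k) \<longlonglongrightarrow> integral\<^sup>L T k"
    proof (rule weak_conv_imp_bdd_ae_continuous_conv[OF _ T _ kB])
      show "emeasure T {x. \<not> isCont k x} = 0"
        using disc[OF False] by (simp add: T.emeasure_eq_measure)
    qed (auto simp: \<sigma>.real_distribution_arctan_law)
    then show ?thesis
      unfolding 1 2 by (intro tendsto_scaleR mass)
  qed
qed

text \<open>Helly selection in the angular variable: the masses converge along a subsequence by
  Bolzano-Weierstrass, the tight angular laws along a further one. The limit measure drops what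
  \<open>T\<close> puts outside the open interval, hence only
  \<open>measure \<nu> UNIV \<le> m\<close>.\<close>

lemma vague_compactness:
  fixes \<sigma> :: "nat \<Rightarrow> real measure"
  assumes fin: "\<And>n. finite_borel_measure (\<sigma> n)"
    and bdd: "Bseq (\<lambda>n. measure (\<sigma> n) UNIV)"
  obtains r \<nu> m where "strict_mono (r :: nat \<Rightarrow> nat)" "finite_borel_measure \<nu>"
    "(\<lambda>n. measure (\<sigma> (r n)) UNIV) \<longlonglongrightarrow> m" "measure \<nu> UNIV \<le> m"
    "\<And>z. Im z > 0 \<Longrightarrow> (\<lambda>n. cauchy_transform (\<sigma> (r n)) z) \<longlonglongrightarrow> cauchy_transform \<nu> z"
    "\<And>a b (g :: real \<Rightarrow> real). a < b \<Longrightarrow> measure \<nu> {a} = 0 \<Longrightarrow> measure \<nu> {b} = 0 \<Longrightarrow>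
      continuous_on UNIV g \<Longrightarrow>
      (\<lambda>n. LINT t|\<sigma> (r n). indicator {a<..<b} t * g t) \<longlonglongrightarrow> (LINT t|\<nu>. indicator {a<..<b} t * g t)"
proof -
  interpret \<sigma>: finite_borel_measure "\<sigma> n" for n by (rule fin)
  let ?I = "{-(pi/2)<..<pi/2}"
  have "tight (\<lambda>n. arctan_law (\<sigma> n))"
    unfolding tight_def
  proof (intro conjI allI impI \<sigma>.real_distribution_arctan_law)
    fix \<epsilon> :: real assume "\<epsilon> > 0"
    then show "\<exists>a b. a < b \<and> (\<forall>n. 1 - \<epsilon> < measure (arctan_law (\<sigma> n)) {a<..b})"
      by (intro exI[of _ "-2"] exI[of _ 2]) (auto simp: \<sigma>.measure_arctan_law)
  qed
  moreover obtain r0 m where r0: "strict_mono (r0 :: nat \<Rightarrow> nat)" "(\<lambda>n. measure (\<sigma> (r0 n)) UNIV) \<longlonglongrightarrow> m"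
    using bounded_imp_convergent_subsequence[of "\<lambda>n. measure (\<sigma> n) UNIV"] bdd
    by (auto simp: Bseq_eq_bounded o_def)
  ultimately obtain r1 T where r1: "strict_mono (r1 :: nat \<Rightarrow> nat)" "real_distribution T"
    "weak_conv_m ((\<lambda>n. arctan_law (\<sigma> n)) \<circ> r0 \<circ> r1) T"
    using tight_imp_convergent_subsubsequence by blast
  interpret T: real_distribution T by (rule r1)
  define r where "r = r0 \<circ> r1"
  have r: "strict_mono r" using r0 r1 by (simp add: r_def strict_mono_o)
  have wc: "weak_conv_m (\<lambda>n. arctan_law (\<sigma> (r n))) T"
    using r1(3) by (simp add: r_def o_def)
  have mr: "(\<lambda>n. measure (\<sigma> (r n)) UNIV) \<longlonglongrightarrow> m"
    using LIMSEQ_subseq_LIMSEQ[OF r0(2) r1(1)] by (simp add: r_def o_def)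
  have m: "m \<ge> 0" using mr by (intro LIMSEQ_le_const) auto
  define \<nu> where "\<nu> = tan_measure m T"
  have fin\<nu>: "finite_borel_measure \<nu>"
    unfolding \<nu>_def by (rule T.finite_borel_measure_tan_measure[OF m])
  interpret \<nu>: finite_borel_measure \<nu> by (rule fin\<nu>)
  note conv = tendsto_integral_tan_measure[OF fin mr r1(2) wc, folded \<nu>_def]
  show ?thesis
  proof (rule that[OF r fin\<nu> mr])
    show "measure \<nu> UNIV \<le> m"
      using T.measure_tan_measure[of UNIV m] m by (simp add: \<nu>_def mult_left_le)
  next
    fix z :: complex assume z: "Im z > 0"
    \<comment> \<open>In the angular variable the Cauchy kernel extends continuously by \<open>0\<close> beyond \<open>\<plusminus>\<pi>/2\<close>.\<close>
    define c where "c x = max (-(pi/2)) (min (pi/2) x)" for x :: real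
    define k where "k x = of_real (cos (c x)) / (of_real (sin (c x)) - z * of_real (cos (c x)))" for x
    \<comment> \<open>The denominator has imaginary part \<open>- Im z * cos x\<close>, and where
      the cosine vanishes the sine is 1 or -1.\<close>
    have nz: "complex_of_real (sin x) - z * of_real (cos x) \<noteq> 0" for x
    proof
      assume *: "complex_of_real (sin x) - z * of_real (cos x) = 0"
      then have "cos x = 0" using z by (auto simp: complex_eq_iff)
      with * show False using sin_zero_abs_cos_one[of x] by (auto simp: complex_eq_iff)
    qed
    have k: "k x = (if x \<in> ?I then 1 / (of_real (tan x) - z) else 0)" for x
    proof (cases "x \<in> ?I")
      case True
      then have "cos x > 0" by (auto intro: cos_gt_zero_pi)
      moreover have "c x = x" using True by (auto simp: c_def)
      ultimately show ?thesis using True nz[of x] of_real_diff_nonzero[OF z, of "tan x"]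
        by (simp add: k_def tan_def field_simps)
    next
      case False
      then have "c x = pi/2 \<or> c x = - (pi/2)" by (auto simp: c_def max_def min_def)
      then have "cos (c x) = 0" by (elim disjE) (simp_all only: cos_minus cos_pi_half)
      then show ?thesis unfolding if_not_P[OF False] by (simp add: k_def)
    qed
    have "continuous_on UNIV k"
      unfolding k_def c_def by (intro continuous_intros ballI nz)
    then have cont: "isCont k x" for x
      by (simp add: continuous_on_eq_continuous_at)
    show "(\<lambda>n. cauchy_transform (\<sigma> (r n)) z) \<longlonglongrightarrow> cauchy_transform \<nu> z"
      unfolding cauchy_transform_def
      by (rule conv[where k = k and B = "1 / Im z", OF k])
         (use norm_cauchy_kernel_le[OF z] cont in \<open>auto\<close>)
  next
    fix a b :: real and g :: "real \<Rightarrow> real"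
    assume ab: "a < b" and a: "measure \<nu> {a} = 0" and b: "measure \<nu> {b} = 0"
      and g: "continuous_on UNIV g"
    have [measurable]: "g \<in> borel_measurable borel"
      using g by (rule borel_measurable_continuous_onI)
    have "compact (g ` {a..b})"
      using g by (intro compact_continuous_image) (auto intro: continuous_on_subset)
    then obtain B where B: "\<And>x. x \<in> {a..b} \<Longrightarrow> norm (g x) \<le> B"
      using compact_imp_bounded[of "g ` {a..b}"] unfolding bounded_iff by blast
    have B0: "B \<ge> 0" using B[of a] ab by (smt (verit) norm_ge_zero atLeastAtMost_iff)
    define k where "k x = (if x \<in> ?I then indicator {a<..<b} (tan x) * g (tan x) else 0)" for x
    let ?J = "{arctan a<..<arctan b}"
    have J: "?J \<subseteq> ?I" using arctan_bounded[of a] arctan_bounded[of b] by auto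
    have k0: "k x = 0" if "x \<notin> ?J" for x
    proof (cases "x \<in> ?I")
      case True
      then have "arctan (tan x) = x" by (auto intro: arctan_tan)
      then have "\<not> (a < tan x \<and> tan x < b)"
        using that by (metis arctan_less_iff greaterThanLessThan_iff)
      then show ?thesis by (simp add: k_def)
    qed (auto simp: k_def)
    have k1: "k x = g (tan x)" if x: "x \<in> ?J" for x
    proof -
      have "arctan (tan x) = x" using x J by (auto intro!: arctan_tan)
      then have "a < tan x \<and> tan x < b"
        using x by (metis arctan_less_iff greaterThanLessThan_iff)
      then show ?thesis using x J by (auto simp: k_def)
    qed
    \<comment> \<open>Only at \<open>arctan a\<close> and \<open>arctan b\<close> can
      \<open>k\<close> jump: inside \<open>?J\<close> it is \<open>g\<close> composed with
      \<open>tan\<close>, and it vanishes off the closed interval, in particular around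
      +-pi/2.\<close>
    have cont: "isCont k x" if "x \<noteq> arctan a" "x \<noteq> arctan b" for x
    proof (cases "x \<in> ?J")
      case True
      have "cos x \<noteq> 0" using True J cos_gt_zero_pi[of x] by force
      then have "isCont (\<lambda>x. g (tan x)) x"
        using g by (intro isCont_o2[OF isCont_tan]) (auto simp: continuous_on_eq_continuous_at)
      moreover have "eventually (\<lambda>y. y \<in> ?J) (nhds x)"
        using True by (intro eventually_nhds_in_open) auto
      then have "eventually (\<lambda>y. k y = g (tan y)) (nhds x)"
        by eventually_elim (rule k1)
      ultimately show ?thesis using isCont_cong[of k "\<lambda>x. g (tan x)" x] by simp
    next
      case False
      then have "x \<in> - {arctan a..arctan b}" using that by auto
      then have "eventually (\<lambda>y. y \<in> - {arctan a..arctan b}) (nhds x)"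
        by (intro eventually_nhds_in_open) auto
      then have "eventually (\<lambda>y. k y = 0) (nhds x)"
        by eventually_elim (rule k0, auto)
      then show ?thesis using isCont_cong[of k "\<lambda>_. 0"] by simp
    qed
    \<comment> \<open>The mass of \<open>\<nu>\<close> at \<open>c\<close> is \<open>m\<close> times
      that of \<open>T\<close> at \<open>arctan c\<close>, so it can be divided by
      \<open>m\<close>.\<close>
    have pt: "measure T {arctan c} = 0" if "measure \<nu> {c} = 0" "m \<noteq> 0" for c
    proof -
      have "?I \<inter> tan -` {c} = {arctan c}"
        using arctan_bounded[of c] by (auto simp: arctan arctan_unique intro: arctan_unique[symmetric])
      then show ?thesis using that T.measure_tan_measure[of "{c}" m] m by (simp add: \<nu>_def)
    qed
    show "(\<lambda>n. LINT t|\<sigma> (r n). indicator {a<..<b} t * g t) \<longlonglongrightarrow> (LINT t|\<nu>. indicator {a<..<b} t * g t)"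
    proof (rule conv[where k = k and B = B])
      show "norm (indicator {a<..<b} x * g x) \<le> B" for x
        using B[of x] B0 by (auto simp: indicator_def)
      assume "m \<noteq> 0"
      have "measure T {x. \<not> isCont k x} \<le> measure T ({arctan a} \<union> {arctan b})"
        by (rule T.finite_measure_mono) (use cont in auto)
      also have "\<dots> \<le> measure T {arctan a} + measure T {arctan b}"
        by (rule measure_Un_le) auto
      also have "\<dots> = 0" using pt a b \<open>m \<noteq> 0\<close> by simp
      finally show "measure T {x. \<not> isCont k x} = 0" using measure_nonneg by (simp add: antisym)
    qed (auto simp: k_def)
  qed
qed

section \<open>Stieltjes inversion\<close>

text \<open>The complement of a countable set is dense, so intervals with endpoints outside
  \<open>D\<close> still generate the Borel sets; they are closed under intersection, and Dynkin's
  uniqueness theorem applies. In use, \<open>D\<close> is the set of atoms.\<close>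

lemma measure_eqI_open_intervals:
  fixes M N :: "real measure"
  assumes sets: "sets M = sets borel" "sets N = sets borel" and D: "countable D"
    and fin: "\<And>a b. emeasure M {a<..<b} < \<infinity>"
    and eq: "\<And>a b. a < b \<Longrightarrow> a \<notin> D \<Longrightarrow> b \<notin> D \<Longrightarrow> emeasure M {a<..<b} = emeasure N {a<..<b}"
  shows "M = N"
proof -
  have avoid: "\<exists>x. a < x \<and> x < b \<and> x \<notin> D" if "a < b" for a b :: real
    using open_minus_countable[OF D, of "{a<..<b}"] that by auto
  define E where "E = (\<lambda>(a, b). {a<..<b}) ` ((- D) \<times> (- D))"
  have gen: "borel = sigma UNIV E"
    unfolding E_def
  proof (rule borel_eq_sigmaI1[OF borel_eq_box])
    fix X :: "real set" assume "X \<in> range (\<lambda>(a, b). box a b)"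
    then obtain a b where X: "X = {a<..<b}" by (auto simp: box_real)
    \<comment> \<open>Endpoints outside \<open>D\<close> tend to \<open>a\<close> from the right and
      to \<open>b\<close> from the left, so countably many such intervals fill
      \<open>{a<..<b}\<close>.\<close>
    obtain a' where a': "\<And>n. a < a' n \<and> a' n < a + 1 / Suc n \<and> a' n \<notin> D"
      using avoid[of a "a + 1 / Suc n" for n] by (metis less_add_same_cancel1 zero_less_divide_1_iff of_nat_0_less_iff zero_less_Suc)
    obtain b' where b': "\<And>n. b - 1 / Suc n < b' n \<and> b' n < b \<and> b' n \<notin> D"
      using avoid[of "b - 1 / Suc n" b for n] by (metis diff_less_eq less_add_same_cancel1 zero_less_divide_1_iff of_nat_0_less_iff zero_less_Suc)
    have "{a<..<b} = (\<Union>n m. {a' n<..<b' m})"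
    proof (intro equalityI subsetI)
      fix x assume x: "x \<in> {a<..<b}"
      obtain n where "1 / Suc n < x - a" using x nat_approx_posE[of "x - a"] by auto
      moreover obtain m where "1 / Suc m < b - x" using x nat_approx_posE[of "b - x"] by auto
      ultimately have "a' n < x" "x < b' m" using a'[of n] b'[of m] by auto
      then show "x \<in> (\<Union>n m. {a' n<..<b' m})" by auto
    next
      fix x assume "x \<in> (\<Union>n m. {a' n<..<b' m})"
      then show "x \<in> {a<..<b}" using a' b' by (auto intro: less_trans)
    qed
    moreover have "(\<Union>n m. {a' n<..<b' m}) \<in> sets (sigma UNIV ((\<lambda>(a, b). {a<..<b}) ` ((- D) \<times> (- D))))"
      by (intro sets.countable_UN'' countableI_type) (use a' b' in \<open>auto intro!: sigma_sets.Basic\<close>)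
    ultimately show "X \<in> sets (sigma UNIV ((\<lambda>(a, b). {a<..<b}) ` ((- D) \<times> (- D))))" using X by simp
  qed auto
  have "sets borel = sigma_sets UNIV E"
    using arg_cong[OF gen, of sets] by simp
  note sb = this
  \<comment> \<open>These endpoints outside \<open>D\<close> give an exhaustion of the line by
    generators of finite mass.\<close>
  obtain c where c: "\<And>n. real n < c n \<and> c n < real n + 1 \<and> c n \<notin> D"
    using avoid[of "real n" "real n + 1" for n] by (metis less_add_one)
  obtain d where d: "\<And>n. - real n - 1 < d n \<and> d n < - real n \<and> d n \<notin> D"
    using avoid[of "- real n - 1" "- real n" for n] by (metis diff_less_eq less_add_one)
  show ?thesis
  proof (rule measure_eqI_generator_eq[where E = E and \<Omega> = UNIV and A = "\<lambda>n. {d n<..<c n}"])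
    show "Int_stable E"
      unfolding Int_stable_def
    proof (intro ballI)
      fix X Y assume "X \<in> E" "Y \<in> E"
      then obtain a b a' b' where "X = {a<..<b}" "Y = {a'<..<b'}" "a \<notin> D" "b \<notin> D" "a' \<notin> D" "b' \<notin> D"
        by (auto simp: E_def)
      then have "X \<inter> Y = {max a a'<..<min b b'}" "max a a' \<notin> D" "min b b' \<notin> D"
        by (auto simp: max_def min_def)
      then show "X \<inter> Y \<in> E" unfolding E_def by auto
    qed
    show "emeasure M X = emeasure N X" if X: "X \<in> E" for X
    proof -
      obtain a b where X: "X = {a<..<b}" "a \<notin> D" "b \<notin> D" using X by (auto simp: E_def)
      show ?thesis by (cases "a < b") (use X eq in auto)
    qed
    show "(\<Union>n. {d n<..<c n}) = UNIV"
    proof (intro equalityI subsetI)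
      fix x :: real
      obtain n where "\<bar>x\<bar> < real n" using reals_Archimedean2 by blast
      then have "x \<in> {d n<..<c n}" using c[of n] d[of n] by auto
      then show "x \<in> (\<Union>n. {d n<..<c n})" by blast
    qed auto
    show "emeasure M {d n<..<c n} \<noteq> \<infinity>" for n using fin[of "d n" "c n"] by auto
  qed (use sets sb c d in \<open>auto simp: E_def\<close>)
qed

text \<open>The heights \<open>1 / real (n + 2)\<close> tend to 0 and stay at most 1/2, hence below
  \<open>\<i>\<close>, where the factor \<open>1 + z\<^sup>2\<close> vanishes.\<close>

lemma arctan_scaled_tendsto:
  "(\<lambda>n. arctan (c / (1 / real (n + 2)))) \<longlonglongrightarrow> pi / 2 * sgn c"
proof (cases c "0 :: real" rule: linorder_cases)
  case less
  then have "filterlim (\<lambda>n. c / (1 / real (n + 2))) at_bot sequentially" by real_asymp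
  then show ?thesis using less filterlim_compose[OF tendsto_arctan_at_bot] by fastforce
next
  case greater
  then have "filterlim (\<lambda>n. c / (1 / real (n + 2))) at_top sequentially" by real_asymp
  then show ?thesis using greater filterlim_compose[OF tendsto_arctan_at_top] by fastforce
qed auto

text \<open>At height \<open>y\<close> the imaginary part of the Cauchy kernel is pi times the
  Poisson kernel. Fubini and integration in \<open>x\<close> give differences of arctangents, and
  dominated convergence gives the limit; its integrand is pi inside the interval, pi/2 at the
  endpoints and 0 outside.\<close>

lemma (in finite_borel_measure) stieltjes_inversion:
  assumes "a < b"
  shows "(\<lambda>n. LINT x|lborel. indicator {a..b} x * Im (cauchy_transform M (Complex x (1 / real (n + 2)))))
    \<longlonglongrightarrow> (LINT t|M. pi / 2 * sgn (b - t) - pi / 2 * sgn (a - t))"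
proof -
  interpret P: pair_sigma_finite lborel M ..
  have eq: "(LINT x|lborel. indicator {a..b} x * Im (cauchy_transform M (Complex x y))) =
      (LINT t|M. arctan ((b - t) / y) - arctan ((a - t) / y))" if y: "y > 0" for y
  proof -
    have pos: "(x - t)\<^sup>2 + y\<^sup>2 > 0" for x t :: real using y by (simp add: add_nonneg_pos)
    have ge: "(x - t)\<^sup>2 + y\<^sup>2 \<ge> y\<^sup>2" for x t :: real by simp
    define f where "f x t = indicator {a..b} x * (y / ((x - t)\<^sup>2 + y\<^sup>2))" for x t :: real
    have [measurable]: "case_prod f \<in> borel_measurable (lborel \<Otimes>\<^sub>M M)"
      unfolding f_def by measurable
    have "Im (cauchy_transform M (Complex x y)) = (LINT t|M. y / ((x - t)\<^sup>2 + y\<^sup>2))" for x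
    proof -
      have "Im (1 / (complex_of_real t - Complex x y)) = y / ((x - t)\<^sup>2 + y\<^sup>2)" for t
        by (simp add: Im_divide power2_commute)
      then show ?thesis
        using integrable_cauchy_kernel[of "Complex x y"] y
        by (simp add: cauchy_transform_def flip: integral_Im)
    qed
    then have "(LINT x|lborel. indicator {a..b} x * Im (cauchy_transform M (Complex x y))) =
        (LINT x|lborel. LINT t|M. f x t)"
      by (simp only: f_def integral_mult_right_zero)
    also have "\<dots> = (LINT t|M. LINT x|lborel. f x t)"
    proof (rule P.Fubini_integral[symmetric])
      \<comment> \<open>The kernel is at most \<open>1 / y\<close>, and the strip over
        \<open>{a..b}\<close> has finite product measure.\<close>
      have "emeasure (lborel \<Otimes>\<^sub>M M) ({a..b} \<times> UNIV) = emeasure lborel {a..b} * emeasure M UNIV"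
        by (intro emeasure_pair_measure_Times) (auto simp: M_is_borel)
      also have "\<dots> < \<infinity>"
        using assms by (simp add: ennreal_mult_less_top emeasure_eq_measure)
      finally have "integrable (lborel \<Otimes>\<^sub>M M) (indicator ({a..b} \<times> UNIV) :: _ \<Rightarrow> real)"
        by (intro integrable_real_indicator pair_measureI) (auto simp: M_is_borel)
      then have "integrable (lborel \<Otimes>\<^sub>M M) (\<lambda>z. (1 / y) * indicator ({a..b} \<times> UNIV) z)"
        by (rule integrable_mult_right)
      then show "integrable (lborel \<Otimes>\<^sub>M M) (case_prod f)"
      proof (rule Bochner_Integration.integrable_bound)
        have "norm (f x t) \<le> norm (1 / y * indicator ({a..b} \<times> UNIV) (x, t))" for x t
        proof -
          have "y / ((x - t)\<^sup>2 + y\<^sup>2) \<le> y / y\<^sup>2"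
            using y ge pos by (intro divide_left_mono) auto
          then show ?thesis
            using y pos[of x t] by (auto simp: f_def indicator_def power2_eq_square)
        qed
        then show "AE z in lborel \<Otimes>\<^sub>M M. norm (case z of (x, t) \<Rightarrow> f x t) \<le>
            norm (1 / y * indicator ({a..b} \<times> UNIV) z)" by auto
      qed simp
    qed
    also have "\<dots> = (LINT t|M. arctan ((b - t) / y) - arctan ((a - t) / y))"
    proof (rule Bochner_Integration.integral_cong[OF refl])
      fix t
      have "((\<lambda>x. arctan ((x - t) / y)) has_real_derivative y / ((x - t)\<^sup>2 + y\<^sup>2)) (at x)" for x
        using y pos[of x t]
        by (auto intro!: derivative_eq_intros simp: divide_simps power2_eq_square)
      moreover have "isCont (\<lambda>x. y / ((x - t)\<^sup>2 + y\<^sup>2)) x" for x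
        using pos[of x t] by (intro continuous_intros) auto
      ultimately have "(LINT x|lborel. y / ((x - t)\<^sup>2 + y\<^sup>2) * indicator {a..b} x) =
          arctan ((b - t) / y) - arctan ((a - t) / y)"
        using assms by (intro integral_FTC_Icc_real) auto
      then show "(LINT x|lborel. f x t) = arctan ((b - t) / y) - arctan ((a - t) / y)"
        by (simp add: f_def mult.commute)
    qed
    finally show ?thesis .
  qed
  have "(\<lambda>n. LINT t|M. arctan ((b - t) / (1 / real (n + 2))) - arctan ((a - t) / (1 / real (n + 2))))
      \<longlonglongrightarrow> (LINT t|M. pi / 2 * sgn (b - t) - pi / 2 * sgn (a - t))"
  proof (rule integral_dominated_convergence[where w = "\<lambda>_. pi"])
    show "AE t in M. (\<lambda>n. arctan ((b - t) / (1 / real (n + 2))) - arctan ((a - t) / (1 / real (n + 2))))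
        \<longlonglongrightarrow> pi / 2 * sgn (b - t) - pi / 2 * sgn (a - t)"
      by (intro AE_I2 tendsto_diff arctan_scaled_tendsto)
    have "norm (arctan u - arctan v) \<le> pi" for u v
      using arctan_bounded[of u] arctan_bounded[of v] by (simp add: abs_if)
    then show "AE t in M. norm (arctan ((b - t) / (1 / real (n + 2))) - arctan ((a - t) / (1 / real (n + 2)))) \<le> pi" for n
      by blast
  qed auto
  then show ?thesis by (simp add: eq)
qed

text \<open>Inversion determines the mass of each interval whose endpoints are not atoms, and a
  finite measure has countably many atoms. The restriction to \<open>Im z < 1\<close> matches the
  heights used in the inversion and leaves out \<open>\<i>\<close>.\<close>

lemma cauchy_transform_inject:
  assumes "finite_borel_measure M" "finite_borel_measure N"
    and eq: "\<And>z. 0 < Im z \<Longrightarrow> Im z < 1 \<Longrightarrow> cauchy_transform M z = cauchy_transform N z"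
  shows "M = N"
proof -
  interpret M: finite_borel_measure M by fact
  interpret N: finite_borel_measure N by fact
  \<comment> \<open>If the endpoints carry no mass, their values pi/2 disappear almost
    everywhere.\<close>
  have mass: "(LINT t|L. pi / 2 * sgn (b - t) - pi / 2 * sgn (a - t)) = pi * measure L {a<..<b}"
    if L: "finite_borel_measure L" and ab: "a < b" "measure L {a} = 0" "measure L {b} = 0" for L and a b :: real
  proof -
    interpret L: finite_borel_measure L by fact
    have "{a} \<in> null_sets L" "{b} \<in> null_sets L"
      using ab by (auto simp: null_sets_def L.emeasure_eq_measure L.M_is_borel)
    then have "AE t in L. t \<notin> {a}" "AE t in L. t \<notin> {b}"
      by (auto dest: AE_not_in)
    then have "AE t in L. pi / 2 * sgn (b - t) - pi / 2 * sgn (a - t) = pi * indicator {a<..<b} t"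
      by eventually_elim (use ab in \<open>auto simp: indicator_def sgn_if\<close>)
    then have "(LINT t|L. pi / 2 * sgn (b - t) - pi / 2 * sgn (a - t)) = (LINT t|L. pi * indicator {a<..<b} t)"
      by (intro integral_cong_AE) auto
    then show ?thesis by (simp add: L.space_eq_UNIV)
  qed
  show ?thesis
  proof (rule measure_eqI_open_intervals[where D = "{x. measure M {x} \<noteq> 0} \<union> {x. measure N {x} \<noteq> 0}"])
    show "countable ({x. measure M {x} \<noteq> 0} \<union> {x. measure N {x} \<noteq> 0})"
      by (intro countable_Un M.countable_support N.countable_support)
    fix a b assume ab: "a < b" "a \<notin> {x. measure M {x} \<noteq> 0} \<union> {x. measure N {x} \<noteq> 0}"
      "b \<notin> {x. measure M {x} \<noteq> 0} \<union> {x. measure N {x} \<noteq> 0}"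
    have "(LINT t|M. pi / 2 * sgn (b - t) - pi / 2 * sgn (a - t)) =
        (LINT t|N. pi / 2 * sgn (b - t) - pi / 2 * sgn (a - t))"
      using M.stieltjes_inversion[OF ab(1)] N.stieltjes_inversion[OF ab(1)]
      by (intro LIMSEQ_unique) (simp_all add: eq)
    then show "emeasure M {a<..<b} = emeasure N {a<..<b}"
      using ab mass[of M a b] mass[of N a b] assms by (simp add: M.emeasure_eq_measure N.emeasure_eq_measure)
  qed (auto simp: M.M_is_borel N.M_is_borel M.emeasure_eq_measure)
qed

section \<open>Vitali's theorem and locally uniform convergence\<close>

text \<open>By Montel every subsequence has a further one converging locally uniformly. Its limit
  agrees with \<open>g\<close> on \<open>M\<close>, hence on \<open>S\<close> by the identity
  theorem, and the subsequence principle returns to the full sequence.\<close>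

theorem Vitali_convergence:
  fixes f :: "nat \<Rightarrow> complex \<Rightarrow> complex"
  assumes S: "open S" "connected S"
    and holf: "\<And>n. f n holomorphic_on S"
    and holg: "g holomorphic_on S"
    and bounded: "\<And>K. compact K \<Longrightarrow> K \<subseteq> S \<Longrightarrow> \<exists>B. \<forall>n. \<forall>z\<in>K. norm (f n z) \<le> B"
    and M: "M \<subseteq> S" "w \<in> S" "w islimpt M"
    and lim: "\<And>z. z \<in> M \<Longrightarrow> (\<lambda>n. f n z) \<longlonglongrightarrow> g z"
    and K: "compact K" "K \<subseteq> S"
  shows "uniform_limit K f g sequentially"
proof (rule filterlim_subseq_subseq)
  fix r :: "nat \<Rightarrow> nat" assume r: "strict_mono r"
  obtain h s where h: "h holomorphic_on S" and s: "strict_mono (s :: nat \<Rightarrow> nat)"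
    and pt: "\<And>z. z \<in> S \<Longrightarrow> (\<lambda>n. f (r (s n)) z) \<longlonglongrightarrow> h z"
    and unif: "\<And>K. compact K \<Longrightarrow> K \<subseteq> S \<Longrightarrow> uniform_limit K ((\<lambda>n. f (r n)) \<circ> s) h sequentially"
  proof (rule Montel[where S = S and \<H> = "range f" and \<F> = "\<lambda>n. f (r n)"])
    show "\<exists>B. \<forall>h\<in>range f. \<forall>z\<in>K. norm (h z) \<le> B" if "compact K" "K \<subseteq> S" for K
      using bounded[OF that] by auto
  qed (use S holf in auto)
  have "h z - g z = 0" if z: "z \<in> S" for z
  proof (rule analytic_continuation[of "\<lambda>z. h z - g z" S M w z])
    fix z assume z: "z \<in> M"
    have "(\<lambda>n. f (r (s n)) z) \<longlonglongrightarrow> g z"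
      using LIMSEQ_subseq_LIMSEQ[OF lim[OF z] strict_mono_o[OF r s]] by (simp add: o_def)
    then show "h z - g z = 0"
      using pt[of z] z M LIMSEQ_unique by auto
  qed (use S M h holg z in \<open>auto intro: holomorphic_intros\<close>)
  then have "uniform_limit K (\<lambda>n. f (r (s n))) g sequentially"
    using unif[OF K] K uniform_limit_cong'[of K "\<lambda>n. f (r (s n))" "\<lambda>n. f (r (s n))" h g sequentially]
    by (auto simp: o_def)
  then show "\<exists>s. strict_mono s \<and> uniform_limit K (\<lambda>n. f (r (s n))) g sequentially"
    using s by blast
qed

section \<open>Bounds and convergence for a polynomial plus a Cauchy transform\<close>

text \<open>The transform in terms of a finite measure that has absorbed the weight;
  \<open>k\<close> stands for \<open>\<kappa> + 1\<close>.\<close>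

definition poly_cauchy_transform :: "nat \<Rightarrow> real measure \<Rightarrow> real poly \<Rightarrow> complex \<Rightarrow> complex" where
  "poly_cauchy_transform k \<sigma> p z =
     poly (map_poly of_real p) z + (1 + z\<^sup>2) ^ k * cauchy_transform \<sigma> z"

text \<open>Summing to a fixed \<open>n\<close> instead of the degree allows polynomials of varying
  degree to be treated term by term.\<close>

lemma poly_of_real_eq_sum:
  assumes "\<forall>i\<ge>n. coeff p i = 0"
  shows "poly (map_poly complex_of_real p) z = (\<Sum>i<n. of_real (coeff p i) * z ^ i)"
proof -
  have "poly (map_poly complex_of_real p) z = (\<Sum>i\<le>degree p. of_real (coeff p i) * z ^ i)"
    by (simp add: poly_altdef degree_map_poly coeff_map_poly)
  also have "\<dots> = (\<Sum>i\<le>max n (degree p). of_real (coeff p i) * z ^ i)"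
    by (rule sum.mono_neutral_left) (auto simp: coeff_eq_0)
  also have "\<dots> = (\<Sum>i<n. of_real (coeff p i) * z ^ i)"
    by (rule sum.mono_neutral_right) (use assms in auto)
  finally show ?thesis .
qed

text \<open>For pairs of the class \<open>mass\<close> holds because the top coefficient dominates
  the mass. Thus the coefficient sum controls the whole function, up to a factor independent of
  \<open>\<sigma>\<close> and \<open>p\<close>.\<close>

lemma norm_poly_cauchy_transform_le:
  assumes \<sigma>: "finite_borel_measure \<sigma>" and p: "\<forall>i\<ge>n. coeff p i = 0"
    and mass: "measure \<sigma> UNIV \<le> (\<Sum>i<n. \<bar>coeff p i\<bar>)" and z: "Im z > 0"
  shows "norm (poly_cauchy_transform k \<sigma> p z) \<le>
    (\<Sum>i<n. \<bar>coeff p i\<bar>) * ((1 + norm z) ^ n + (1 + (norm z)\<^sup>2) ^ k / Im z)"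
proof -
  let ?N = "\<Sum>i<n. \<bar>coeff p i\<bar>"
  interpret finite_borel_measure \<sigma> by (rule \<sigma>)
  have "norm (poly (map_poly complex_of_real p) z) \<le> (\<Sum>i<n. norm (of_real (coeff p i) * z ^ i))"
    unfolding poly_of_real_eq_sum[OF p] by (rule norm_sum)
  also have "\<dots> \<le> (\<Sum>i<n. \<bar>coeff p i\<bar> * (1 + norm z) ^ n)"
  proof (rule sum_mono)
    fix i assume "i \<in> {..<n}"
    have "norm z ^ i \<le> (1 + norm z) ^ i" by (intro power_mono) auto
    also have "\<dots> \<le> (1 + norm z) ^ n"
      using \<open>i \<in> {..<n}\<close> by (intro power_increasing) auto
    finally show "norm (complex_of_real (coeff p i) * z ^ i) \<le> \<bar>coeff p i\<bar> * (1 + norm z) ^ n"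
      by (simp add: norm_mult norm_power mult_left_mono)
  qed
  finally have 1: "norm (poly (map_poly complex_of_real p) z) \<le> ?N * (1 + norm z) ^ n"
    by (simp add: sum_distrib_right)
  have "norm (1 + z\<^sup>2) \<le> 1 + (norm z)\<^sup>2"
    using norm_triangle_ineq[of 1 "z\<^sup>2"] by (simp add: norm_power)
  then have 2: "norm ((1 + z\<^sup>2) ^ k) \<le> (1 + (norm z)\<^sup>2) ^ k"
    unfolding norm_power by (intro power_mono) auto
  have 3: "norm (cauchy_transform \<sigma> z) \<le> ?N / Im z"
    using norm_cauchy_transform_le[OF z] mass z by (meson divide_right_mono less_imp_le order_trans)
  have "norm (poly_cauchy_transform k \<sigma> p z) \<le> ?N * (1 + norm z) ^ n + (1 + (norm z)\<^sup>2) ^ k * (?N / Im z)"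
    unfolding poly_cauchy_transform_def
    by (intro order_trans[OF norm_triangle_ineq] add_mono 1, unfold norm_mult, intro mult_mono 2 3) auto
  then show ?thesis by (simp add: algebra_simps)
qed

lemma poly_cauchy_transform_bound_compact:
  assumes K: "compact K" "K \<subseteq> upper_half_plane"
  obtains B where "\<And>\<sigma> p z. finite_borel_measure \<sigma> \<Longrightarrow> \<forall>i\<ge>n. coeff p i = 0 \<Longrightarrow>
    measure \<sigma> UNIV \<le> (\<Sum>i<n. \<bar>coeff p i\<bar>) \<Longrightarrow> z \<in> K \<Longrightarrow>
    norm (poly_cauchy_transform k \<sigma> p z) \<le> (\<Sum>i<n. \<bar>coeff p i\<bar>) * B"
proof -
  have "continuous_on K (\<lambda>z. (1 + norm z) ^ n + (1 + (norm z)\<^sup>2) ^ k / Im z)"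
    by (intro continuous_intros) (use K in \<open>auto simp: upper_half_plane_def\<close>)
  then have "bounded ((\<lambda>z. (1 + norm z) ^ n + (1 + (norm z)\<^sup>2) ^ k / Im z) ` K)"
    using K compact_continuous_image compact_imp_bounded by blast
  then obtain B where B: "\<And>z. z \<in> K \<Longrightarrow> (1 + norm z) ^ n + (1 + (norm z)\<^sup>2) ^ k / Im z \<le> B"
    unfolding bounded_iff using abs_le_D1 by fastforce
  show ?thesis
  proof (rule that)
    fix \<sigma> p z
    assume a: "finite_borel_measure \<sigma>" "\<forall>i\<ge>n. coeff p i = 0" "measure \<sigma> UNIV \<le> (\<Sum>i<n. \<bar>coeff p i\<bar>)"
      and z: "z \<in> K"
    have "Im z > 0" using z K by (auto simp: upper_half_plane_def)
    then have "norm (poly_cauchy_transform k \<sigma> p z) \<le>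
        (\<Sum>i<n. \<bar>coeff p i\<bar>) * ((1 + norm z) ^ n + (1 + (norm z)\<^sup>2) ^ k / Im z)"
      by (rule norm_poly_cauchy_transform_le[OF a])
    also have "\<dots> \<le> (\<Sum>i<n. \<bar>coeff p i\<bar>) * B"
      by (intro mult_left_mono B z sum_nonneg) auto
    finally show "norm (poly_cauchy_transform k \<sigma> p z) \<le> (\<Sum>i<n. \<bar>coeff p i\<bar>) * B" .
  qed
qed

lemma holomorphic_poly_cauchy_transform:
  assumes "finite_borel_measure \<sigma>"
  shows "poly_cauchy_transform k \<sigma> p holomorphic_on upper_half_plane"
  unfolding poly_cauchy_transform_def
  by (intro holomorphic_intros finite_borel_measure.holomorphic_cauchy_transform[OF assms])

lemma sphere_subset_upper_half_plane: "sphere \<i> (1/2) \<subseteq> upper_half_plane"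
proof
  fix z assume "z \<in> sphere \<i> (1/2)"
  then have "\<bar>Im (\<i> - z)\<bar> \<le> 1/2"
    using abs_Im_le_cmod[of "\<i> - z"] by (simp add: dist_norm)
  then show "z \<in> upper_half_plane" by (simp add: mem_upper_half_plane abs_if split: if_splits)
qed

lemma coeffs_tendsto_0:
  assumes p: "\<And>n. \<forall>i\<ge>2 * k. coeff (p n) i = 0"
    and F: "\<And>n. F n holomorphic_on upper_half_plane"
    and lim: "uniform_limit (sphere \<i> (1/2))
      (\<lambda>n z. poly (map_poly of_real (p n)) z + (1 + z\<^sup>2) ^ k * F n z) (\<lambda>_. 0) sequentially"
  shows "(\<lambda>n. coeff (p n) i) \<longlonglongrightarrow> (0 :: real)"
proof -
  obtain C where C: "\<And>(p :: real poly) F B i.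
    \<forall>i\<ge>2 * k. coeff p i = 0 \<Longrightarrow> F holomorphic_on upper_half_plane \<Longrightarrow>
    \<forall>z\<in>sphere \<i> (1/2). norm (poly (map_poly of_real p) z + (1 + z\<^sup>2) ^ k * F z) \<le> B \<Longrightarrow>
    \<bar>coeff p i\<bar> \<le> C * B"
    using real_poly_bound_exists[of k] by metis
  show ?thesis
  proof (rule tendstoI)
    fix e :: real assume e: "e > 0"
    \<comment> \<open>The sign of \<open>C\<close> is unknown; the added 1 keeps the denominator
      positive and makes the final estimate strict.\<close>
    let ?d = "e / (\<bar>C\<bar> + 1)"
    have "\<forall>\<^sub>F n in sequentially. \<forall>z\<in>sphere \<i> (1/2).
        norm (poly (map_poly of_real (p n)) z + (1 + z\<^sup>2) ^ k * F n z) < ?d"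
      using uniform_limitD[OF lim, of ?d] e by simp
    then show "\<forall>\<^sub>F n in sequentially. dist (coeff (p n) i) 0 < e"
    proof eventually_elim
      case (elim n)
      then have "\<bar>coeff (p n) i\<bar> \<le> C * ?d"
        by (intro C[OF p F] ballI less_imp_le) blast
      also have "\<dots> \<le> \<bar>C\<bar> * ?d" using e by (intro mult_right_mono) auto
      also have "\<dots> < e" using e by (simp add: field_simps)
      finally show ?case by simp
    qed
  qed
qed

text \<open>The interpolation bound is applied to \<open>p m - p n\<close> with the factor
  \<open>F m - F n\<close>. A difference of Cauchy transforms need not come from a positive measure,
  which is why that bound admits arbitrary holomorphic factors.\<close>

lemma coeffs_convergent:
  assumes p: "\<And>n. \<forall>i\<ge>2 * k. coeff (p n) i = 0"
    and F: "\<And>n. F n holomorphic_on upper_half_plane"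
    and lim: "uniform_limit (sphere \<i> (1/2))
      (\<lambda>n z. poly (map_poly of_real (p n)) z + (1 + z\<^sup>2) ^ k * F n z) g sequentially"
  shows "convergent (\<lambda>n. coeff (p n) i :: real)"
proof -
  obtain C where C: "\<And>(p :: real poly) F B i.
    \<forall>i\<ge>2 * k. coeff p i = 0 \<Longrightarrow> F holomorphic_on upper_half_plane \<Longrightarrow>
    \<forall>z\<in>sphere \<i> (1/2). norm (poly (map_poly of_real p) z + (1 + z\<^sup>2) ^ k * F z) \<le> B \<Longrightarrow>
    \<bar>coeff p i\<bar> \<le> C * B"
    using real_poly_bound_exists[of k] by metis
  define q where "q n z = poly (map_poly of_real (p n)) z + (1 + z\<^sup>2) ^ k * F n z" for n z
  have "Cauchy (\<lambda>n. coeff (p n) i)"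
  proof (rule metric_CauchyI)
    fix e :: real assume e: "e > 0"
    let ?d = "e / (2 * \<bar>C\<bar> + 1)"
    have "\<forall>\<^sub>F n in sequentially. \<forall>z\<in>sphere \<i> (1/2). dist (q n z) (g z) < ?d"
      using uniform_limitD[OF lim, of ?d] e by (simp add: q_def)
    then obtain N where N: "\<And>n z. n \<ge> N \<Longrightarrow> z \<in> sphere \<i> (1/2) \<Longrightarrow> dist (q n z) (g z) < ?d"
      unfolding eventually_sequentially by blast
    have "dist (coeff (p m) i) (coeff (p n) i) < e" if mn: "m \<ge> N" "n \<ge> N" for m n
    proof -
      have "\<bar>coeff (p m - p n) i\<bar> \<le> C * (2 * ?d)"
      proof (rule C[where F = "\<lambda>z. F m z - F n z"])
        show "\<forall>z\<in>sphere \<i> (1/2). norm (poly (map_poly of_real (p m - p n)) z + (1 + z\<^sup>2) ^ k * (F m z - F n z)) \<le> 2 * ?d"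
        proof
          fix z assume z: "z \<in> sphere \<i> (1/2)"
          have "map_poly complex_of_real (p m - p n) = map_poly of_real (p m) - map_poly of_real (p n)"
            by (rule poly_eqI) (simp add: coeff_map_poly)
          then have "poly (map_poly complex_of_real (p m - p n)) z =
              poly (map_poly of_real (p m)) z - poly (map_poly of_real (p n)) z" by simp
          then have "poly (map_poly of_real (p m - p n)) z + (1 + z\<^sup>2) ^ k * (F m z - F n z) = q m z - q n z"
            by (simp add: q_def algebra_simps)
          moreover have "dist (q m z) (q n z) \<le> 2 * ?d"
            using N[OF mn(1) z] N[OF mn(2) z] dist_triangle2[of "q m z" "q n z" "g z"] by linarith
          ultimately show "norm (poly (map_poly of_real (p m - p n)) z + (1 + z\<^sup>2) ^ k * (F m z - F n z)) \<le> 2 * ?d"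
            by (simp add: dist_norm)
        qed
      qed (use p F in \<open>auto intro: holomorphic_intros\<close>)
      also have "\<dots> \<le> \<bar>C\<bar> * (2 * ?d)" using e by (intro mult_right_mono) auto
      also have "\<dots> < e" using e by (simp add: field_simps)
      finally show ?thesis by (simp add: dist_real_def)
    qed
    then show "\<exists>N. \<forall>m\<ge>N. \<forall>n\<ge>N. dist (coeff (p m) i) (coeff (p n) i) < e" by blast
  qed
  then show ?thesis by (simp add: Cauchy_convergent_iff)
qed

text \<open>The normalised polynomials \<open>P n\<close> have coefficient sum 1, while Vitali's
  theorem and interpolation would force their coefficients to 0.\<close>

lemma coeff_sums_bounded:
  fixes p :: "nat \<Rightarrow> real poly"
  assumes \<sigma>: "\<And>n. finite_borel_measure (\<sigma> n)"
    and p: "\<And>n. \<forall>i\<ge>2 * k. coeff (p n) i = 0"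
    and mass: "\<And>n. measure (\<sigma> n) UNIV \<le> (\<Sum>i<2 * k. \<bar>coeff (p n) i\<bar>)"
    and M: "M \<subseteq> upper_half_plane" "w \<in> upper_half_plane" "w islimpt M"
    and lim: "\<And>z. z \<in> M \<Longrightarrow> convergent (\<lambda>n. poly_cauchy_transform k (\<sigma> n) (p n) z)"
  shows "\<exists>B. \<forall>n. (\<Sum>i<2 * k. \<bar>coeff (p n) i\<bar>) \<le> B"
proof (rule ccontr)
  assume unbounded: "\<not> ?thesis"
  define N where "N n = (\<Sum>i<2 * k. \<bar>coeff (p n) i\<bar>)" for n
  have "\<exists>m. N m > real (Suc n)" for n
    using unbounded unfolding N_def[symmetric] by (meson not_le)
  \<comment> \<open>Only the growth of \<open>N (r n)\<close> counts; \<open>r\<close> may fail to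
    increase, because at a point of \<open>M\<close> the unnormalised values are bounded over all
    indices.\<close>
  then obtain r where r: "\<And>n. N (r n) > real (Suc n)" by metis
  have Npos: "N (r n) > 0" for n using r[of n] by (simp add: order_le_less_trans[rotated])
  define F where "F n z = of_real (1 / N (r n)) * cauchy_transform (\<sigma> (r n)) z" for n z
  define P where "P n = smult (1 / N (r n)) (p (r n))" for n
  define f where "f n z = of_real (1 / N (r n)) * poly_cauchy_transform k (\<sigma> (r n)) (p (r n)) z" for n z
  have feq: "f n z = poly (map_poly of_real (P n)) z + (1 + z\<^sup>2) ^ k * F n z" for n z
  proof -
    have "map_poly complex_of_real (P n) = smult (of_real (1 / N (r n))) (map_poly of_real (p (r n)))"
      by (rule poly_eqI) (simp add: coeff_map_poly P_def)
    then show ?thesis by (simp add: f_def F_def poly_cauchy_transform_def algebra_simps)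
  qed
  have "uniform_limit (sphere \<i> (1/2)) f (\<lambda>_. 0) sequentially"
  proof (rule Vitali_convergence[OF open_upper_half_plane connected_upper_half_plane _ _ _ M])
    show "f n holomorphic_on upper_half_plane" for n
      unfolding f_def by (intro holomorphic_intros holomorphic_poly_cauchy_transform \<sigma>)
    show "\<exists>B. \<forall>n. \<forall>z\<in>K. norm (f n z) \<le> B" if K: "compact K" "K \<subseteq> upper_half_plane" for K
    proof -
      obtain B where B: "\<And>\<sigma> p z. finite_borel_measure \<sigma> \<Longrightarrow> \<forall>i\<ge>2 * k. coeff p i = 0 \<Longrightarrow>
        measure \<sigma> UNIV \<le> (\<Sum>i<2 * k. \<bar>coeff p i\<bar>) \<Longrightarrow> z \<in> K \<Longrightarrow>
        norm (poly_cauchy_transform k \<sigma> p z) \<le> (\<Sum>i<2 * k. \<bar>coeff p i\<bar>) * B"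
        using poly_cauchy_transform_bound_compact[OF K] by metis
      have "norm (f n z) \<le> B" if "z \<in> K" for n z
      proof -
        have "norm (poly_cauchy_transform k (\<sigma> (r n)) (p (r n)) z) \<le> N (r n) * B"
          unfolding N_def by (rule B[OF \<sigma> p mass that])
        then show ?thesis
          using Npos[of n] by (simp add: f_def norm_divide divide_le_eq mult.commute)
      qed
      then show ?thesis by blast
    qed
    show "(\<lambda>n. f n z) \<longlonglongrightarrow> 0" if "z \<in> M" for z
    proof -
      obtain B where B: "\<And>n. norm (poly_cauchy_transform k (\<sigma> n) (p n) z) \<le> B"
        using convergent_imp_Bseq[OF lim[OF \<open>z \<in> M\<close>]] unfolding Bseq_def by blast
      have "norm (f n z) \<le> B / real (Suc n)" for n
      proof -
        have "norm (f n z) \<le> B / N (r n)"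
          using B[of "r n"] Npos[of n] by (simp add: f_def norm_divide divide_right_mono)
        also have "\<dots> \<le> B / real (Suc n)"
          using r[of n] B[of 0] Npos[of n] by (intro divide_left_mono) (auto intro: order_trans[OF norm_ge_zero])
        finally show ?thesis .
      qed
      moreover have "(\<lambda>n. B / real (Suc n)) \<longlonglongrightarrow> 0"
        by real_asymp
      ultimately show ?thesis
        by (rule Lim_null_comparison[OF always_eventually[OF allI]])
    qed
  qed (use sphere_subset_upper_half_plane in auto)
  then have lim0: "uniform_limit (sphere \<i> (1/2))
      (\<lambda>n z. poly (map_poly of_real (P n)) z + (1 + z\<^sup>2) ^ k * F n z) (\<lambda>_. 0) sequentially"
    by (simp only: feq[abs_def])
  have holF: "F n holomorphic_on upper_half_plane" for n
    unfolding F_def by (intro holomorphic_intros finite_borel_measure.holomorphic_cauchy_transform \<sigma>)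
  have P0: "\<forall>i\<ge>2 * k. coeff (P n) i = 0" for n using p by (simp add: P_def)
  have "(\<lambda>n. coeff (P n) i) \<longlonglongrightarrow> 0" for i
    by (rule coeffs_tendsto_0[OF P0 holF lim0])
  then have "(\<lambda>n. \<Sum>i<2 * k. \<bar>coeff (P n) i\<bar>) \<longlonglongrightarrow> (\<Sum>i<2 * k. \<bar>0\<bar>)"
    by (intro tendsto_sum tendsto_rabs)
  moreover have "(\<Sum>i<2 * k. \<bar>coeff (P n) i\<bar>) = 1" for n
  proof -
    have "(\<Sum>i<2 * k. \<bar>coeff (P n) i\<bar>) = N (r n) / N (r n)"
      unfolding N_def[of "r n"] sum_divide_distrib using Npos[of n]
      by (intro sum.cong) (auto simp: P_def abs_mult N_def)
    then show ?thesis using Npos[of n] by simp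
  qed
  ultimately have "(\<lambda>n :: nat. 1 :: real) \<longlonglongrightarrow> 0" by simp
  then show False using LIMSEQ_unique tendsto_const by fastforce
qed

text \<open>Convergence on \<open>M\<close> bounds the coefficient sums, these bound the functions
  on compact sets, and Vitali's theorem applies.\<close>

lemma pointwise_imp_uniform_limit:
  assumes \<sigma>: "\<And>n. finite_borel_measure (\<sigma> n)"
    and p: "\<And>n. \<forall>i\<ge>2 * k. coeff (p n) i = 0"
    and mass: "\<And>n. measure (\<sigma> n) UNIV \<le> (\<Sum>i<2 * k. \<bar>coeff (p n) i\<bar>)"
    and M: "M \<subseteq> upper_half_plane" "w \<in> upper_half_plane" "w islimpt M"
    and lim: "\<And>z. z \<in> M \<Longrightarrow> (\<lambda>n. poly_cauchy_transform k (\<sigma> n) (p n) z) \<longlonglongrightarrow> g z"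
    and g: "g holomorphic_on upper_half_plane"
    and K: "compact K" "K \<subseteq> upper_half_plane"
  shows "uniform_limit K (\<lambda>n. poly_cauchy_transform k (\<sigma> n) (p n)) g sequentially"
proof (rule Vitali_convergence[OF open_upper_half_plane connected_upper_half_plane _ g _ M lim K])
  show "poly_cauchy_transform k (\<sigma> n) (p n) holomorphic_on upper_half_plane" for n
    by (rule holomorphic_poly_cauchy_transform[OF \<sigma>])
  have "\<exists>N. \<forall>n. (\<Sum>i<2 * k. \<bar>coeff (p n) i\<bar>) \<le> N"
    by (rule coeff_sums_bounded[OF \<sigma> p mass M]) (rule convergentI[OF lim])
  then obtain N where N: "\<And>n. (\<Sum>i<2 * k. \<bar>coeff (p n) i\<bar>) \<le> N" by blast
  show "\<exists>B. \<forall>n. \<forall>z\<in>L. norm (poly_cauchy_transform k (\<sigma> n) (p n) z) \<le> B"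
    if L: "compact L" "L \<subseteq> upper_half_plane" for L
  proof -
    obtain B where B: "\<And>\<sigma> p z. finite_borel_measure \<sigma> \<Longrightarrow> \<forall>i\<ge>2 * k. coeff p i = 0 \<Longrightarrow>
      measure \<sigma> UNIV \<le> (\<Sum>i<2 * k. \<bar>coeff p i\<bar>) \<Longrightarrow> z \<in> L \<Longrightarrow>
      norm (poly_cauchy_transform k \<sigma> p z) \<le> (\<Sum>i<2 * k. \<bar>coeff p i\<bar>) * B"
      using poly_cauchy_transform_bound_compact[OF L] by metis
    have "norm (poly_cauchy_transform k (\<sigma> n) (p n) z) \<le> N * \<bar>B\<bar>" if "z \<in> L" for n z
    proof -
      have "norm (poly_cauchy_transform k (\<sigma> n) (p n) z) \<le> (\<Sum>i<2 * k. \<bar>coeff (p n) i\<bar>) * B"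
        by (rule B[OF \<sigma> p mass that])
      also have "\<dots> \<le> (\<Sum>i<2 * k. \<bar>coeff (p n) i\<bar>) * \<bar>B\<bar>"
        by (intro mult_left_mono sum_nonneg) auto
      also have "\<dots> \<le> N * \<bar>B\<bar>" by (intro mult_right_mono N) auto
      finally show ?thesis .
    qed
    then show ?thesis by blast
  qed
qed

section \<open>Limits in the classes of measure and polynomial pairs\<close>

text \<open>For \<open>k = \<kappa> + 1\<close> the integrability condition of the class says that
  this measure is finite. Its density is positive and finite, so \<open>unweighted_measure\<close>
  undoes it.\<close>

definition weighted_measure :: "nat \<Rightarrow> real measure \<Rightarrow> real measure" where
  "weighted_measure k \<mu> = density \<mu> (\<lambda>t. ennreal (1 / (1 + t\<^sup>2) ^ k))"

definition unweighted_measure :: "nat \<Rightarrow> real measure \<Rightarrow> real measure" where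
  "unweighted_measure k \<nu> = density \<nu> (\<lambda>t. ennreal ((1 + t\<^sup>2) ^ k))"

lemma one_plus_square_pos: "0 < 1 + (t :: real)\<^sup>2"
  by (simp add: add_pos_nonneg)

lemma unweighted_weighted_measure:
  assumes [measurable_cong]: "sets \<mu> = sets borel"
  shows "unweighted_measure k (weighted_measure k \<mu>) = \<mu>"
proof -
  have "ennreal (1 / (1 + t\<^sup>2) ^ k) * ennreal ((1 + t\<^sup>2) ^ k) = 1" for t :: real
    using one_plus_square_pos[of t] by (simp add: less_imp_le flip: ennreal_mult)
  then show ?thesis
    unfolding weighted_measure_def unweighted_measure_def
    by (subst density_density_eq) (simp_all add: density_1)
qed

lemma weighted_unweighted_measure:
  assumes [measurable_cong]: "sets \<mu> = sets borel"
  shows "weighted_measure k (unweighted_measure k \<mu>) = \<mu>"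
proof -
  have "ennreal ((1 + t\<^sup>2) ^ k) * ennreal (1 / (1 + t\<^sup>2) ^ k) = 1" for t :: real
    using one_plus_square_pos[of t] by (simp add: less_imp_le flip: ennreal_mult)
  then show ?thesis
    unfolding weighted_measure_def unweighted_measure_def
    by (subst density_density_eq) (simp_all add: density_1)
qed

text \<open>The weight is positive at \<open>a\<close>, so the condition on endpoints may be read
  off either measure.\<close>

lemma emeasure_weighted_measure_singleton:
  assumes [measurable_cong]: "sets \<mu> = sets borel"
  shows "emeasure (weighted_measure k \<mu>) {a} = 0 \<longleftrightarrow> emeasure \<mu> {a} = 0"
proof -
  have "emeasure (weighted_measure k \<mu>) {a} =
      (\<integral>\<^sup>+t. ennreal (1 / (1 + a\<^sup>2) ^ k) * indicator {a} t \<partial>\<mu>)"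
    unfolding weighted_measure_def
    by (subst emeasure_density) (auto simp: assms indicator_def intro!: nn_integral_cong)
  also have "\<dots> = ennreal (1 / (1 + a\<^sup>2) ^ k) * emeasure \<mu> {a}"
    by (rule nn_integral_cmult_indicator) (simp add: assms)
  finally show ?thesis
    using zero_less_power[OF one_plus_square_pos[of a], of k] by (simp add: ennreal_eq_0_iff not_le)
qed

lemma mem_E_le_iff:
  assumes sets [measurable_cong]: "sets \<mu> = sets borel"
  shows "(\<mu>, p) \<in> E_le \<kappa> \<longleftrightarrow> finite_borel_measure (weighted_measure (\<kappa> + 1) \<mu>) \<and>
    degree p \<le> 2 * \<kappa> + 1 \<and> measure (weighted_measure (\<kappa> + 1) \<mu>) UNIV \<le> coeff p (2 * \<kappa> + 1)"
proof -
  let ?w = "\<lambda>t :: real. 1 / (1 + t\<^sup>2) ^ (\<kappa> + 1)"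
  let ?\<sigma> = "weighted_measure (\<kappa> + 1) \<mu>"
  have w: "0 \<le> ?w t" for t by simp
  have sp: "space \<mu> = UNIV" using sets_eq_imp_space_eq[OF sets] by simp
  have em: "emeasure ?\<sigma> UNIV = (\<integral>\<^sup>+t. ennreal (?w t) \<partial>\<mu>)"
    unfolding weighted_measure_def by (subst emeasure_density) (auto simp: sets)
  have int: "integrable \<mu> ?w \<longleftrightarrow> finite_borel_measure ?\<sigma>"
  proof -
    have "integrable \<mu> ?w \<longleftrightarrow> (\<integral>\<^sup>+t. ennreal (?w t) \<partial>\<mu>) < \<infinity>"
      by (subst integrable_iff_bounded) auto
    also have "\<dots> \<longleftrightarrow> finite_measure ?\<sigma>"
    proof
      assume "(\<integral>\<^sup>+t. ennreal (?w t) \<partial>\<mu>) < \<infinity>"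
      then show "finite_measure ?\<sigma>"
        using em sp by (intro finite_measureI) (simp add: weighted_measure_def)
    next
      assume "finite_measure ?\<sigma>"
      then show "(\<integral>\<^sup>+t. ennreal (?w t) \<partial>\<mu>) < \<infinity>"
        using em finite_measure.emeasure_finite[of ?\<sigma> UNIV] by (simp add: top.not_eq_extremum)
    qed
    finally show ?thesis
      by (simp add: finite_borel_measure_def finite_borel_measure_axioms_def weighted_measure_def sets)
  qed
  have mass: "(LINT t|\<mu>. ?w t) = measure ?\<sigma> UNIV"
    unfolding measure_def em by (rule integral_eq_nn_integral) auto
  show ?thesis
    unfolding E_le_def mem_Collect_eq prod.case by (simp only: int mass sets simp_thms)
qed

lemma cauchy_type_transform_eq:
  assumes [measurable_cong]: "sets \<mu> = sets borel"
  shows "cauchy_type_transform \<kappa> \<mu> p z =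
    poly_cauchy_transform (\<kappa> + 1) (weighted_measure (\<kappa> + 1) \<mu>) p z"
proof -
  have "cauchy_transform (weighted_measure (\<kappa> + 1) \<mu>) z =
      (LINT t|\<mu>. (1 / (1 + t\<^sup>2) ^ (\<kappa> + 1)) *\<^sub>R (1 / (of_real t - z)))"
    unfolding cauchy_transform_def weighted_measure_def
    by (rule integral_density) auto
  also have "\<dots> = (LINT t|\<mu>. 1 / (of_real t - z) * of_real (1 / (1 + t\<^sup>2) ^ (\<kappa> + 1)))"
    by (intro Bochner_Integration.integral_cong refl) (simp only: scaleR_conv_of_real mult.commute)
  finally show ?thesis
    by (simp only: cauchy_type_transform_def poly_cauchy_transform_def)
qed

text \<open>On a bounded interval the inverse weight is bounded, so the mass is finite. An indicator
  times a continuous function, integrated against a finite measure, is the form in which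
  \<open>vague_compactness\<close> passes to the limit.\<close>

lemma emeasure_interval_eq_weighted:
  assumes sets [measurable_cong]: "sets \<mu> = sets borel"
    and fin: "finite_borel_measure (weighted_measure k \<mu>)"
  shows "emeasure \<mu> {a<..<b} =
    ennreal (LINT t|weighted_measure k \<mu>. indicator {a<..<b} t * (1 + t\<^sup>2) ^ k)"
proof -
  let ?\<sigma> = "weighted_measure k \<mu>"
  interpret finite_borel_measure ?\<sigma> by (rule fin)
  define B where "B = (1 + (max \<bar>a\<bar> \<bar>b\<bar>)\<^sup>2) ^ k"
  have B: "norm (indicator {a<..<b} t * (1 + t\<^sup>2) ^ k) \<le> B" for t :: real
  proof (cases "t \<in> {a<..<b}")
    case True
    then have "\<bar>t\<bar> \<le> max \<bar>a\<bar> \<bar>b\<bar>" by auto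
    then have "t\<^sup>2 \<le> (max \<bar>a\<bar> \<bar>b\<bar>)\<^sup>2" using power_mono[of "\<bar>t\<bar>" "max \<bar>a\<bar> \<bar>b\<bar>" 2] by simp
    then have "(1 + t\<^sup>2) ^ k \<le> B" unfolding B_def by (intro power_mono) auto
    then show ?thesis using True by simp
  qed (simp add: B_def)
  have "emeasure \<mu> {a<..<b} = emeasure (unweighted_measure k ?\<sigma>) {a<..<b}"
    using unweighted_weighted_measure[OF sets] by simp
  also have "\<dots> = (\<integral>\<^sup>+t. ennreal (indicator {a<..<b} t * (1 + t\<^sup>2) ^ k) \<partial>?\<sigma>)"
    unfolding unweighted_measure_def
    by (subst emeasure_density) (auto simp: M_is_borel indicator_def intro!: nn_integral_cong)
  also have "\<dots> = ennreal (LINT t|?\<sigma>. indicator {a<..<b} t * (1 + t\<^sup>2) ^ k)"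
    by (rule nn_integral_eq_integral)
       (auto intro!: integrable_const_bound[where B = B] B simp del: real_norm_def)
  finally show ?thesis .
qed

lemma continuous_one_plus_square_power: "continuous_on UNIV (\<lambda>t :: real. (1 + t\<^sup>2) ^ k)"
  by (intro continuous_intros)

lemma tendsto_poly_of_real:
  assumes "\<And>n. \<forall>i\<ge>m. coeff (p n) i = 0" "\<forall>i\<ge>m. coeff p0 i = 0"
    and "poly_tendsto p p0"
  shows "(\<lambda>n. poly (map_poly complex_of_real (p n)) z) \<longlonglongrightarrow> poly (map_poly of_real p0) z"
  unfolding poly_of_real_eq_sum[OF assms(1)] poly_of_real_eq_sum[OF assms(2)]
  using assms(3) unfolding poly_tendsto_def
  by (intro tendsto_sum tendsto_mult tendsto_of_real tendsto_const) auto

lemma poly_tendsto_subseq: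
  assumes "poly_tendsto p p0" "strict_mono s"
  shows "poly_tendsto (\<lambda>n. p (s n)) p0"
  unfolding poly_tendsto_def
proof
  fix i
  have "(\<lambda>n. coeff (p n) i) \<longlonglongrightarrow> coeff p0 i" using assms(1) by (simp add: poly_tendsto_def)
  from LIMSEQ_subseq_LIMSEQ[OF this assms(2)]
  show "(\<lambda>n. coeff (p (s n)) i) \<longlonglongrightarrow> coeff p0 i" by (simp add: o_def)
qed

text \<open>The converging top coefficients bound the weighted masses, so vague compactness applies;
  removing the weight from the limit gives \<open>\<mu>0\<close>. Loss of mass is compatible with
  the inequality defining the class, so \<open>p0\<close> remains admissible.\<close>

lemma vague_compactness_E_le:
  fixes \<mu> :: "nat \<Rightarrow> real measure"
  assumes E: "\<And>n. (\<mu> n, p n) \<in> E_le \<kappa>" and p0: "poly_tendsto p p0" "degree p0 \<le> 2 * \<kappa> + 1"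
  shows "\<exists>s \<mu>0. strict_mono (s :: nat \<Rightarrow> nat) \<and> (\<mu>0, p0) \<in> E_le \<kappa> \<and>
    (\<forall>z\<in>upper_half_plane. (\<lambda>n. cauchy_type_transform \<kappa> (\<mu> (s n)) (p (s n)) z)
      \<longlonglongrightarrow> cauchy_type_transform \<kappa> \<mu>0 p0 z) \<and>
    (\<forall>a b. a < b \<longrightarrow> emeasure \<mu>0 {a} = 0 \<longrightarrow> emeasure \<mu>0 {b} = 0 \<longrightarrow>
      (\<lambda>n. emeasure (\<mu> (s n)) {a<..<b}) \<longlonglongrightarrow> emeasure \<mu>0 {a<..<b})"
proof -
  let ?k = "\<kappa> + 1"
  have sets: "sets (\<mu> n) = sets borel" for n using E[of n] by (simp add: E_le_def)
  note mem = E[unfolded mem_E_le_iff[OF sets]]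
  let ?\<sigma> = "\<lambda>n. weighted_measure ?k (\<mu> n)"
  have fin: "finite_borel_measure (?\<sigma> n)" for n using mem by blast
  have c: "(\<lambda>n. coeff (p n) (2 * \<kappa> + 1)) \<longlonglongrightarrow> coeff p0 (2 * \<kappa> + 1)"
    using p0 by (simp add: poly_tendsto_def)
  have bseq: "Bseq (\<lambda>n. measure (?\<sigma> n) UNIV)"
  proof -
    obtain B where B: "\<And>n. norm (coeff (p n) (2 * \<kappa> + 1)) \<le> B"
      using convergent_imp_Bseq[OF convergentI[OF c]] unfolding Bseq_def by blast
    have "norm (measure (?\<sigma> n) UNIV) \<le> B" for n
      using mem[of n] order_trans[OF abs_ge_self B[of n, unfolded real_norm_def]] by auto
    then show ?thesis by (rule BseqI')
  qed
  show ?thesis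
  proof (rule vague_compactness[OF fin bseq])
    fix s :: "nat \<Rightarrow> nat" and \<nu> m
    assume s: "strict_mono s" and \<nu>: "finite_borel_measure \<nu>"
      and m: "(\<lambda>n. measure (?\<sigma> (s n)) UNIV) \<longlonglongrightarrow> m" "measure \<nu> UNIV \<le> m"
      and ct: "\<And>z. Im z > 0 \<Longrightarrow> (\<lambda>n. cauchy_transform (?\<sigma> (s n)) z) \<longlonglongrightarrow> cauchy_transform \<nu> z"
      and iv: "\<And>a b (g :: real \<Rightarrow> real). a < b \<Longrightarrow> measure \<nu> {a} = 0 \<Longrightarrow> measure \<nu> {b} = 0 \<Longrightarrow>
        continuous_on UNIV g \<Longrightarrow>
        (\<lambda>n. LINT t|?\<sigma> (s n). indicator {a<..<b} t * g t) \<longlonglongrightarrow> (LINT t|\<nu>. indicator {a<..<b} t * g t)"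
    interpret \<nu>: finite_borel_measure \<nu> by (rule \<nu>)
    let ?\<mu>0 = "unweighted_measure ?k \<nu>"
    have sets0: "sets ?\<mu>0 = sets borel" by (simp add: unweighted_measure_def \<nu>.M_is_borel)
    have w0: "weighted_measure ?k ?\<mu>0 = \<nu>" by (rule weighted_unweighted_measure[OF \<nu>.M_is_borel])
    \<comment> \<open>The masses stay below the top coefficients in the limit, and
      \<open>\<nu>\<close> has at most mass \<open>m\<close>.\<close>
    have "m \<le> coeff p0 (2 * \<kappa> + 1)"
      by (rule LIMSEQ_le[OF m(1) LIMSEQ_subseq_LIMSEQ[OF c s]]) (use mem in auto)
    then have E0: "(?\<mu>0, p0) \<in> E_le \<kappa>"
      unfolding mem_E_le_iff[OF sets0] w0 using m(2) p0(2) \<nu> order_trans by blast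
    have p: "\<forall>i\<ge>2 * \<kappa> + 2. coeff (p n) i = 0" for n
      using mem[of n] by (auto intro: coeff_eq_0)
    have q: "\<forall>i\<ge>2 * \<kappa> + 2. coeff p0 i = 0"
      using p0 by (auto intro: coeff_eq_0)
    show ?thesis
    proof (intro exI conjI ballI allI impI)
      show "strict_mono s" "(?\<mu>0, p0) \<in> E_le \<kappa>" by fact+
    next
      fix z assume "z \<in> upper_half_plane"
      then have z: "Im z > 0" by (simp add: upper_half_plane_def)
      have ps: "poly_tendsto (\<lambda>n. p (s n)) p0"
        by (rule poly_tendsto_subseq[OF p0(1) s])
      show "(\<lambda>n. cauchy_type_transform \<kappa> (\<mu> (s n)) (p (s n)) z) \<longlonglongrightarrow> cauchy_type_transform \<kappa> ?\<mu>0 p0 z"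
        unfolding cauchy_type_transform_eq[OF sets] cauchy_type_transform_eq[OF sets0] poly_cauchy_transform_def w0
        by (intro tendsto_add tendsto_mult tendsto_const ct[OF z] tendsto_poly_of_real[OF p q ps])
    next
      fix a b :: real assume ab: "a < b" "emeasure ?\<mu>0 {a} = 0" "emeasure ?\<mu>0 {b} = 0"
      have atom: "measure \<nu> {c} = 0" if "emeasure ?\<mu>0 {c} = 0" for c
        using that emeasure_weighted_measure_singleton[OF sets0, of ?k c] unfolding w0
        by (metis measure_def enn2real_0)
      show "(\<lambda>n. emeasure (\<mu> (s n)) {a<..<b}) \<longlonglongrightarrow> emeasure ?\<mu>0 {a<..<b}"
        unfolding emeasure_interval_eq_weighted[OF sets fin]
          emeasure_interval_eq_weighted[OF sets0, of ?k, unfolded w0, OF \<nu>]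
        by (intro tendsto_ennrealI iv atom ab continuous_one_plus_square_power)
    qed
  qed
qed

text \<open>The common polynomial cancels, and division by the power of \<open>1 + z\<^sup>2\<close>
  leaves equal Cauchy transforms of the weighted measures.\<close>

lemma E_le_eq_of_transform:
  assumes E: "(\<mu>, p) \<in> E_le \<kappa>" "(\<nu>, p) \<in> E_le \<kappa>"
    and eq: "\<And>z. z \<in> upper_half_plane \<Longrightarrow> cauchy_type_transform \<kappa> \<mu> p z = cauchy_type_transform \<kappa> \<nu> p z"
  shows "\<mu> = \<nu>"
proof -
  have sets: "sets \<mu> = sets borel" "sets \<nu> = sets borel" using E by (auto simp: E_le_def)
  note mem = E(1)[unfolded mem_E_le_iff[OF sets(1)]] E(2)[unfolded mem_E_le_iff[OF sets(2)]]
  have "weighted_measure (\<kappa> + 1) \<mu> = weighted_measure (\<kappa> + 1) \<nu>"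
  proof (rule cauchy_transform_inject)
    fix z assume z: "0 < Im z" "Im z < 1"
    \<comment> \<open>Both zeros \<open>\<i>\<close> and \<open>-\<i>\<close> lie outside the strip
      \<open>0 < Im z < 1\<close>.\<close>
    have "1 + z\<^sup>2 = (z - \<i>) * (z + \<i>)" by (simp add: algebra_simps power2_eq_square)
    moreover have "z \<noteq> \<i>" "z + \<i> \<noteq> 0" using z by (auto simp: complex_eq_iff)
    ultimately have "(1 + z\<^sup>2) ^ (\<kappa> + 1) \<noteq> 0" by simp
    then show "cauchy_transform (weighted_measure (\<kappa> + 1) \<mu>) z = cauchy_transform (weighted_measure (\<kappa> + 1) \<nu>) z"
      using eq[of z] z
      by (simp add: mem_upper_half_plane cauchy_type_transform_eq[OF sets(1)]
          cauchy_type_transform_eq[OF sets(2)] poly_cauchy_transform_def del: power_Suc)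
  qed (use mem in auto)
  then show ?thesis
    using unweighted_weighted_measure[OF sets(1)] unweighted_weighted_measure[OF sets(2)] by metis
qed

text \<open>The weighted measures are finite, so the atoms of both measures together are countable
  and can be avoided as endpoints. Two limits are thereby compared where both are known.\<close>

lemma E_le_eq_of_intervals:
  assumes E: "(\<mu>, p) \<in> E_le \<kappa>" "(\<nu>, r) \<in> E_le \<kappa>"
    and eq: "\<And>a b. a < b \<Longrightarrow> emeasure \<mu> {a} = 0 \<Longrightarrow> emeasure \<mu> {b} = 0 \<Longrightarrow>
      emeasure \<nu> {a} = 0 \<Longrightarrow> emeasure \<nu> {b} = 0 \<Longrightarrow> emeasure \<mu> {a<..<b} = emeasure \<nu> {a<..<b}"
  shows "\<mu> = \<nu>"
proof -
  have sets: "sets \<mu> = sets borel" "sets \<nu> = sets borel" using E by (auto simp: E_le_def)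
  note mem = E(1)[unfolded mem_E_le_iff[OF sets(1)]] E(2)[unfolded mem_E_le_iff[OF sets(2)]]
  have ctbl: "countable {x. emeasure \<rho> {x} \<noteq> 0}"
    if l: "sets \<rho> = sets borel" "finite_borel_measure (weighted_measure (\<kappa> + 1) \<rho>)" for \<rho> :: "real measure"
  proof -
    interpret finite_borel_measure "weighted_measure (\<kappa> + 1) \<rho>" by (rule l)
    have "emeasure \<rho> {x} = 0 \<longleftrightarrow> measure (weighted_measure (\<kappa> + 1) \<rho>) {x} = 0" for x
      unfolding emeasure_weighted_measure_singleton[OF l(1), of "\<kappa> + 1", symmetric]
      unfolding emeasure_eq_measure by (simp add: ennreal_eq_0_iff measure_le_0_iff)
    then show ?thesis using countable_support by simp
  qed
  show ?thesis
  proof (rule measure_eqI_open_intervals[OF sets, where D = "{x. emeasure \<mu> {x} \<noteq> 0} \<union> {x. emeasure \<nu> {x} \<noteq> 0}"])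
    show "emeasure \<mu> {a<..<b} < \<infinity>" for a b
      unfolding emeasure_interval_eq_weighted[OF sets(1) conjunct1[OF mem(1)]] by simp
  qed (use ctbl sets mem eq in auto)
qed

section \<open>Equivalence of pointwise, locally uniform and vague convergence\<close>

theorem theorem2p12:
  fixes \<kappa> :: nat
    and \<mu> :: "nat \<Rightarrow> real measure"
    and p :: "nat \<Rightarrow> real poly"
    and q :: "nat \<Rightarrow> complex \<Rightarrow> complex"
    and q0 :: "complex \<Rightarrow> complex"
  assumes "\<And>n. (\<mu> n, p n) \<in> E_le \<kappa>"
    and "\<And>n z. z \<in> upper_half_plane \<Longrightarrow> q n z = cauchy_type_transform \<kappa> (\<mu> n) (p n) z"
    and "q0 holomorphic_on upper_half_plane"
  shows "((\<exists>M \<subseteq> upper_half_plane. (\<exists>w \<in> upper_half_plane. w islimpt M) \<and>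
             (\<forall>z\<in>M. (\<lambda>n. q n z) \<longlonglongrightarrow> q0 z))
          \<longleftrightarrow> locally_uniform_limit upper_half_plane q q0)
       \<and> (locally_uniform_limit upper_half_plane q q0
          \<longleftrightarrow> (\<exists>\<mu>0 p0. (\<mu>0, p0) \<in> E_le \<kappa> \<and>
                (\<forall>z\<in>upper_half_plane. q0 z = cauchy_type_transform \<kappa> \<mu>0 p0 z) \<and>
                poly_tendsto p p0 \<and>
                (\<forall>a b :: real. a < b \<and> emeasure \<mu>0 {a} = 0 \<and> emeasure \<mu>0 {b} = 0 \<longrightarrow>
                   (\<lambda>n. emeasure (\<mu> n) {a<..<b}) \<longlonglongrightarrow> emeasure \<mu>0 {a<..<b})))"
    (is "(?i \<longleftrightarrow> ?ii) \<and> (_ \<longleftrightarrow> ?iii)")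
proof -
  let ?\<sigma> = "\<lambda>n. weighted_measure (\<kappa> + 1) (\<mu> n)"
  have sets: "sets (\<mu> n) = sets borel" for n using assms(1)[of n] by (simp add: E_le_def)
  note mem = assms(1)[unfolded mem_E_le_iff[OF sets]]
  have fin: "finite_borel_measure (?\<sigma> n)" for n using mem by blast
  have pc: "\<forall>i\<ge>2 * (\<kappa> + 1). coeff (p n) i = 0" for n
    using mem[of n] by (auto intro: coeff_eq_0)
  have mass: "measure (?\<sigma> n) UNIV \<le> (\<Sum>i<2 * (\<kappa> + 1). \<bar>coeff (p n) i\<bar>)" for n
  proof -
    have "measure (?\<sigma> n) UNIV \<le> \<bar>coeff (p n) (2 * \<kappa> + 1)\<bar>"
      using mem[of n] abs_ge_self order_trans by blast
    \<comment> \<open>The index \<open>2 * \<kappa> + 1\<close> is the last of the summation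
      range.\<close>
    also have "\<dots> \<le> (\<Sum>i<2 * (\<kappa> + 1). \<bar>coeff (p n) i\<bar>)"
      by (rule member_le_sum) auto
    finally show ?thesis .
  qed
  have q: "q n z = poly_cauchy_transform (\<kappa> + 1) (?\<sigma> n) (p n) z" if "z \<in> upper_half_plane" for n z
    using assms(2)[OF that] cauchy_type_transform_eq[OF sets] by simp
  have lul_iff: "?ii \<longleftrightarrow> (\<forall>K. compact K \<and> K \<subseteq> upper_half_plane \<longrightarrow>
      uniform_limit K (\<lambda>n. poly_cauchy_transform (\<kappa> + 1) (?\<sigma> n) (p n)) q0 sequentially)"
    unfolding locally_uniform_limit_iff_compact[OF open_upper_half_plane]
    by (intro all_cong uniform_limit_cong') (auto simp: q)
  have pointwise: "(\<lambda>n. q n z) \<longlonglongrightarrow> q0 z" if ?ii "z \<in> upper_half_plane" for z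
    using that(1)[unfolded locally_uniform_limit_iff_compact[OF open_upper_half_plane], rule_format, of "{z}"]
      that(2) by simp
  have i_ii: ?ii if i: ?i
  proof -
    obtain M w where M: "M \<subseteq> upper_half_plane" "w \<in> upper_half_plane" "w islimpt M"
      and lim: "\<And>z. z \<in> M \<Longrightarrow> (\<lambda>n. q n z) \<longlonglongrightarrow> q0 z" using i by blast
    have lim': "(\<lambda>n. poly_cauchy_transform (\<kappa> + 1) (?\<sigma> n) (p n) z) \<longlonglongrightarrow> q0 z" if "z \<in> M" for z
      using lim[OF that] q M(1) that by (simp add: subset_iff)
    show ?thesis
      unfolding lul_iff
      using pointwise_imp_uniform_limit[OF fin pc mass M lim' assms(3)] by blast
  qed
  have ii_i: ?i if ?ii
    using pointwise[OF that] interior_limit_point[of \<i> upper_half_plane] open_upper_half_plane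
    by (intro exI[of _ upper_half_plane])
       (auto simp: interior_open mem_upper_half_plane intro!: bexI[of _ \<i>])
  have ii_iii: ?iii if ii: ?ii
  proof -
    have "convergent (\<lambda>n. coeff (p n) i)" for i
    proof (rule coeffs_convergent[OF pc])
      show "cauchy_transform (?\<sigma> n) holomorphic_on upper_half_plane" for n
        by (rule finite_borel_measure.holomorphic_cauchy_transform[OF fin])
      show "uniform_limit (sphere \<i> (1/2)) (\<lambda>n z. poly (map_poly of_real (p n)) z +
          (1 + z\<^sup>2) ^ (\<kappa> + 1) * cauchy_transform (?\<sigma> n) z) q0 sequentially"
        using ii sphere_subset_upper_half_plane compact_sphere
        unfolding lul_iff poly_cauchy_transform_def[abs_def] by blast
    qed
    then obtain L where L: "\<And>i. (\<lambda>n. coeff (p n) i) \<longlonglongrightarrow> L i"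
      unfolding convergent_def by metis
    have L0: "L i = 0" if "i \<ge> 2 * (\<kappa> + 1)" for i
      using LIMSEQ_unique[OF L[of i], of 0] pc that by simp
    \<comment> \<open>The coefficient limits vanish from index \<open>2 * (\<kappa> + 1)\<close> on,
      hence form a polynomial of admissible degree.\<close>
    define p0 where "p0 = (\<Sum>i<2 * (\<kappa> + 1). monom (L i) i)"
    have "coeff p0 i = (\<Sum>j<2 * (\<kappa> + 1). if j = i then L j else 0)" for i
      by (simp add: p0_def coeff_sum)
    then have c0: "coeff p0 i = L i" for i
      using L0[of i] by (simp add: sum.delta not_less)
    have p0: "poly_tendsto p p0" unfolding poly_tendsto_def c0 using L by blast
    have deg: "degree p0 \<le> 2 * \<kappa> + 1"
      by (rule degree_le) (use L0 in \<open>auto simp: c0\<close>)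
    \<comment> \<open>Used twice: along the whole sequence to obtain a representing measure, and
      along arbitrary subsequences to prove convergence of interval masses.\<close>
    have sub: "\<exists>s \<nu>. strict_mono (s :: nat \<Rightarrow> nat) \<and> (\<nu>, p0) \<in> E_le \<kappa> \<and>
        (\<forall>z\<in>upper_half_plane. q0 z = cauchy_type_transform \<kappa> \<nu> p0 z) \<and>
        (\<forall>a b. a < b \<and> emeasure \<nu> {a} = 0 \<and> emeasure \<nu> {b} = 0 \<longrightarrow>
          (\<lambda>n. emeasure (\<mu> (r (s n))) {a<..<b}) \<longlonglongrightarrow> emeasure \<nu> {a<..<b})"
      if r: "strict_mono r" for r :: "nat \<Rightarrow> nat"
    proof -
      have pr: "poly_tendsto (\<lambda>n. p (r n)) p0"
        by (rule poly_tendsto_subseq[OF p0 r])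
      obtain s \<nu> where s: "strict_mono (s :: nat \<Rightarrow> nat)" and \<nu>: "(\<nu>, p0) \<in> E_le \<kappa>"
        and lim: "\<And>z. z \<in> upper_half_plane \<Longrightarrow>
          (\<lambda>n. cauchy_type_transform \<kappa> (\<mu> (r (s n))) (p (r (s n))) z) \<longlonglongrightarrow> cauchy_type_transform \<kappa> \<nu> p0 z"
        and iv: "\<And>a b. a < b \<Longrightarrow> emeasure \<nu> {a} = 0 \<Longrightarrow> emeasure \<nu> {b} = 0 \<Longrightarrow>
          (\<lambda>n. emeasure (\<mu> (r (s n))) {a<..<b}) \<longlonglongrightarrow> emeasure \<nu> {a<..<b}"
        using vague_compactness_E_le[OF assms(1) pr deg] by blast
      have "q0 z = cauchy_type_transform \<kappa> \<nu> p0 z" if z: "z \<in> upper_half_plane" for z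
        using lim[OF z] LIMSEQ_subseq_LIMSEQ[OF pointwise[OF ii z] strict_mono_o[OF r s]]
        by (intro LIMSEQ_unique) (simp_all add: o_def assms(2)[OF z])
      then show ?thesis using s \<nu> iv by blast
    qed
    obtain \<mu>0 where \<mu>0: "(\<mu>0, p0) \<in> E_le \<kappa>"
        "\<And>z. z \<in> upper_half_plane \<Longrightarrow> q0 z = cauchy_type_transform \<kappa> \<mu>0 p0 z"
      using sub[OF strict_mono_id] by blast
    have "(\<lambda>n. emeasure (\<mu> n) {a<..<b}) \<longlonglongrightarrow> emeasure \<mu>0 {a<..<b}"
      if ab: "a < b" "emeasure \<mu>0 {a} = 0" "emeasure \<mu>0 {b} = 0" for a b
    proof (rule filterlim_subseq_subseq)
      fix r :: "nat \<Rightarrow> nat" assume "strict_mono r"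
      from sub[OF this] obtain s \<nu> where s: "strict_mono (s :: nat \<Rightarrow> nat)" "(\<nu>, p0) \<in> E_le \<kappa>"
        "\<And>z. z \<in> upper_half_plane \<Longrightarrow> q0 z = cauchy_type_transform \<kappa> \<nu> p0 z"
        "\<And>a b. a < b \<Longrightarrow> emeasure \<nu> {a} = 0 \<Longrightarrow> emeasure \<nu> {b} = 0 \<Longrightarrow>
          (\<lambda>n. emeasure (\<mu> (r (s n))) {a<..<b}) \<longlonglongrightarrow> emeasure \<nu> {a<..<b}" by blast
      \<comment> \<open>Both measures represent \<open>q0\<close> with the same polynomial, so the
        limit does not depend on the subsequence.\<close>
      have "\<nu> = \<mu>0"
        by (rule E_le_eq_of_transform[OF s(2) \<mu>0(1)]) (use s(3) \<mu>0(2) in metis)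
      then show "\<exists>s. strict_mono s \<and> (\<lambda>n. emeasure (\<mu> (r (s n))) {a<..<b}) \<longlonglongrightarrow> emeasure \<mu>0 {a<..<b}"
        using s(1) s(4)[of a b] ab by blast
    qed
    then show ?thesis using \<mu>0 p0 by blast
  qed
  have iii_ii: ?ii if iii: ?iii
  proof -
    obtain \<mu>0 p0 where E0: "(\<mu>0, p0) \<in> E_le \<kappa>"
      and q0: "\<And>z. z \<in> upper_half_plane \<Longrightarrow> q0 z = cauchy_type_transform \<kappa> \<mu>0 p0 z"
      and p0: "poly_tendsto p p0"
      and iv0: "\<And>a b. a < b \<Longrightarrow> emeasure \<mu>0 {a} = 0 \<Longrightarrow> emeasure \<mu>0 {b} = 0 \<Longrightarrow>
        (\<lambda>n. emeasure (\<mu> n) {a<..<b}) \<longlonglongrightarrow> emeasure \<mu>0 {a<..<b}"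
      using iii by blast
    have deg: "degree p0 \<le> 2 * \<kappa> + 1" using E0 by (simp add: E_le_def)
    \<comment> \<open>Interval masses do not show what escapes to infinity. Compactness supplies
      convergent transforms along a further subsequence, and the intervals then identify its limit
      measure.\<close>
    have lim: "(\<lambda>n. q n z) \<longlonglongrightarrow> q0 z" if z: "z \<in> upper_half_plane" for z
    proof (rule filterlim_subseq_subseq)
      fix r :: "nat \<Rightarrow> nat" assume r: "strict_mono r"
      have pr: "poly_tendsto (\<lambda>n. p (r n)) p0"
        by (rule poly_tendsto_subseq[OF p0 r])
      obtain s \<nu> where s: "strict_mono (s :: nat \<Rightarrow> nat)" and \<nu>: "(\<nu>, p0) \<in> E_le \<kappa>"
        and lim: "\<And>z. z \<in> upper_half_plane \<Longrightarrow>
          (\<lambda>n. cauchy_type_transform \<kappa> (\<mu> (r (s n))) (p (r (s n))) z) \<longlonglongrightarrow> cauchy_type_transform \<kappa> \<nu> p0 z"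
        and iv: "\<And>a b. a < b \<Longrightarrow> emeasure \<nu> {a} = 0 \<Longrightarrow> emeasure \<nu> {b} = 0 \<Longrightarrow>
          (\<lambda>n. emeasure (\<mu> (r (s n))) {a<..<b}) \<longlonglongrightarrow> emeasure \<nu> {a<..<b}"
        using vague_compactness_E_le[OF assms(1) pr deg] by blast
      have "\<nu> = \<mu>0"
      proof (rule E_le_eq_of_intervals[OF \<nu> E0])
        fix a b :: real
        assume ab: "a < b" "emeasure \<nu> {a} = 0" "emeasure \<nu> {b} = 0" "emeasure \<mu>0 {a} = 0" "emeasure \<mu>0 {b} = 0"
        show "emeasure \<nu> {a<..<b} = emeasure \<mu>0 {a<..<b}"
          using iv[of a b] LIMSEQ_subseq_LIMSEQ[OF iv0[of a b] strict_mono_o[OF r s]] ab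
          by (intro LIMSEQ_unique) (simp_all add: o_def)
      qed
      then show "\<exists>s. strict_mono s \<and> (\<lambda>n. q (r (s n)) z) \<longlonglongrightarrow> q0 z"
        using s lim[OF z] by (auto simp: assms(2)[OF z] q0[OF z])
    qed
    \<comment> \<open>Convergence at every point of the half-plane is the first statement with
      \<open>M\<close> the half-plane itself, so the implication \<open>i_ii\<close>
      finishes.\<close>
    have "\<i> islimpt upper_half_plane"
      by (intro interior_limit_point) (simp add: interior_open open_upper_half_plane mem_upper_half_plane)
    then show ?thesis
      using lim by (intro i_ii exI[of _ upper_half_plane]) (auto simp: mem_upper_half_plane intro!: bexI[of _ \<i>])
  qed
  show ?thesis using i_ii ii_i ii_iii iii_ii by blast
qed

end
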